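(* Let $X$ be a separable Banach space and let $\mu$ be a centered Gaussian measure on $X$. Then the origin $0 \in X$ is both a strong mode and a generalized mode of $\mu$, whereas every $x \in X \setminus \{0\}$ is neither a strong mode nor a generalized mode of $\mu$.
   Context: For a probability measure $\mu$ on a separable Banach space $X$, let $B^\delta(x) \subset X$ denote the open ball of radius $\delta$ around $x$, and for $\delta>0$ let $M^\delta := \sup_{x\in X}\mu(B^\delta(x))$. A point $\hat x\in X$ is a (strong) mode of $\mu$ if $\lim_{\delta\to 0} \mu(B^\delta(\hat x))/M^\delta = 1$. A point $\hat x\in X$ is a generalized mode of $\mu$ if for every sequence $\{\delta_n\}_{n\in\mathbb{N}}\subset(0,\infty)$ with $\delta_n\to 0$ there exists a sequence $\{w_n\}_{n\in\mathbb{N}}\subset X$ (called an approximating sequence) with $w_n\to\hat x$ in $X$ and $\lim_{n\to\infty}\mu(B^{\delta_n}(w_n))/M^{\delta_n}=1$. *)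

theory Defs
  imports "HOL-Probability.Probability"
begin

text \<open>The supremum is taken over a nonempty set of reals, bounded by 1 if the measure is a
  probability measure.\<close>

definition max_ball_mass :: "'a::metric_space measure \<Rightarrow> real \<Rightarrow> real" where
  "max_ball_mass \<mu> \<delta> = (SUP x. measure \<mu> (ball x \<delta>))"

definition strong_mode :: "'a::metric_space measure \<Rightarrow> 'a \<Rightarrow> bool" where
  "strong_mode \<mu> x \<longleftrightarrow>
     ((\<lambda>\<delta>. measure \<mu> (ball x \<delta>) / max_ball_mass \<mu> \<delta>) \<longlongrightarrow> 1) (at_right 0)"

definition generalized_mode :: "'a::metric_space measure \<Rightarrow> 'a \<Rightarrow> bool" where
  "generalized_mode \<mu> x \<longleftrightarrow>
     (\<forall>\<delta> :: nat \<Rightarrow> real. (\<forall>n. \<delta> n > 0) \<longrightarrow> \<delta> \<longlonglongrightarrow> 0 \<longrightarrow>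
        (\<exists>w :: nat \<Rightarrow> 'a. w \<longlonglongrightarrow> x \<and>
           (\<lambda>n. measure \<mu> (ball (w n) (\<delta> n)) / max_ball_mass \<mu> (\<delta> n)) \<longlonglongrightarrow> 1))"

text \<open>The one-dimensional normal distribution with mean \<open>m\<close> and standard deviation \<open>\<sigma> \<ge> 0\<close>,
  where \<open>\<sigma> = 0\<close> gives the Dirac measure at \<open>m\<close>.\<close>

definition normal_distribution :: "real \<Rightarrow> real \<Rightarrow> real measure" where
  "normal_distribution m \<sigma> =
     (if \<sigma> = 0 then return borel m else density lborel (normal_density m \<sigma>))"

text \<open>A Borel probability measure is Gaussian if its image under every continuous linear
  functional is a normal distribution on the line. Degenerate normal distributions are
  admitted, as usual, so the support may be a proper subspace.\<close>

definition gaussian_measure :: "'a::real_normed_vector measure \<Rightarrow> bool" where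
  "gaussian_measure \<mu> \<longleftrightarrow>
     prob_space \<mu> \<and> sets \<mu> = sets borel \<and>
     (\<forall>f :: 'a \<Rightarrow> real. bounded_linear f \<longrightarrow>
        (\<exists>m \<sigma>. \<sigma> \<ge> 0 \<and> distr \<mu> borel f = normal_distribution m \<sigma>))"

text \<open>For a Gaussian measure every \<open>f\<close> below is integrable, so the integral is a genuine mean.\<close>

definition centered_gaussian_measure :: "'a::real_normed_vector measure \<Rightarrow> bool" where
  "centered_gaussian_measure \<mu> \<longleftrightarrow>
     gaussian_measure \<mu> \<and>
     (\<forall>f :: 'a \<Rightarrow> real. bounded_linear f \<longrightarrow> (\<integral>x. f x \<partial>\<mu>) = 0)"

end

theory Submission
  imports Defs
begin

text \<open>
  Two inequalities carry the proof. Anderson's inequality \<open>\<mu>(B(w,\<delta>)) \<le> \<mu>(B(0,\<delta>))\<close>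
  (\<open>ball_mass_le\<close>) identifies the maximal ball mass with the mass of the centred ball, which
  is positive because the space is separable; hence the ratio at the origin is constantly 1.
  For \<open>x \<noteq> 0\<close> the ratio \<open>\<mu>(B(w,\<delta>)) / \<mu>(B(0,\<delta>))\<close> stays below some \<open>q < 1\<close> uniformly for
  \<open>w\<close> near \<open>x\<close> and small \<open>\<delta>\<close> (\<open>off_centre_ratio\<close>), which excludes generalized and therefore
  also strong modes.

  Anderson's inequality is derived from a single property of \<open>\<mu>\<close>: the product \<open>\<mu> \<otimes> \<mu>\<close> is
  invariant under the orthogonal map \<open>(x, y) \<mapsto> ((x + y)/\<surd>2, (x - y)/\<surd>2)\<close>. Let \<open>N(y,r)\<close> be
  the mass of the set \<open>|f\<^sub>j - y\<^sub>j| \<le> r\<^sub>j\<close>, for finitely many functionals \<open>f\<^sub>1, \<dots>, f\<^sub>n\<close>.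
  Invariance gives \<open>N(y,r)\<^sup>2 = \<integral> N(\<surd>2 y, \<surd>2 r - |f(v)|) d\<mu>(v)\<close>. If \<open>N(y,r) \<le> S N(0,r)\<close>
  holds for all \<open>y\<close> and \<open>r\<close>, then inserting it on the right and using the same identity for
  \<open>y = 0\<close> improves the constant to \<open>\<surd>S\<close>; iteration leads to the constant 1. To start the
  iteration with a finite constant, the identity also gives
  \<open>N(y,r)\<^sup>2 \<le> N(\<surd>2 y, \<surd>2 r) N(0, \<surd>2 r)\<close>, and covering a box by \<open>2\<^sup>n\<close> boxes that are
  smaller by the factor \<open>\<surd>2\<close> turns this into \<open>S = 4\<^sup>n\<close>. Balls are limits of such boxes by
  the Hahn-Banach theorem.

  The invariance survives multiplication of \<open>\<mu>\<close> by the density \<open>exp(\<theta> f\<^sup>2)\<close>, because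
  \<open>f(x)\<^sup>2 + f(y)\<^sup>2\<close> is itself invariant. So Anderson's inequality also holds for the
  tilted measure \<open>\<nu>\<close>. With \<open>f(x) = \<parallel>x\<parallel>\<close> and \<open>\<theta> > 0\<close> the density is larger near \<open>x\<close> than
  near 0 by a definite factor, and \<open>\<nu>(B(w,\<delta>)) \<le> \<nu>(B(0,\<delta>))\<close> becomes a strict gap for \<open>\<mu>\<close>.

  That \<open>\<mu> \<otimes> \<mu>\<close> is invariant follows by comparing characteristic functionals: on both sides the
  variance enters through \<open>E(g\<^sup>2 + h\<^sup>2)\<close>, which the rotation preserves. This needs the
  uniqueness theorem \<open>measure_eqI_characteristic_functional\<close> for measures on a separable
  normed space, which is reduced to Levy's theorem on the line.
\<close>

section \<open>Norming functionals\<close>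

definition sublinear :: "('a::real_vector \<Rightarrow> real) \<Rightarrow> bool" where
  "sublinear p \<longleftrightarrow> (\<forall>x y. p (x + y) \<le> p x + p y) \<and> (\<forall>c x. c \<ge> 0 \<longrightarrow> p (c *\<^sub>R x) = c * p x)"

lemma sublinear_zero: "sublinear p \<Longrightarrow> p 0 = 0"
  unfolding sublinear_def by (metis mult_zero_left order_refl scaleR_zero_left)

lemma sublinear_neg_lower: "sublinear p \<Longrightarrow> - p (- x) \<le> p x"
proof -
  assume p: "sublinear p"
  have "p (x + - x) \<le> p x + p (- x)" using p unfolding sublinear_def by blast
  then show ?thesis using sublinear_zero[OF p] by simp
qed

text \<open>This functional lies below \<open>p\<close> and takes a value of at most \<open>-p(y)\<close> at \<open>-y\<close>. It serves twice:
  minimality of \<open>p\<close> forces it to equal \<open>p\<close>, and applied to the norm it pins down the value of a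
  dominated functional at a prescribed vector.\<close>

definition ray_infimum :: "('a::real_vector \<Rightarrow> real) \<Rightarrow> 'a \<Rightarrow> 'a \<Rightarrow> real" where
  "ray_infimum p y x = (INF t\<in>{0..}. p (x + t *\<^sub>R y) - t * p y)"

lemma ray_infimum_bdd:
  assumes "sublinear p"
  shows "bdd_below ((\<lambda>t. p (x + t *\<^sub>R y) - t * p y) ` {0..})"
proof (rule bdd_belowI2[where m = "- p (- x)"])
  fix t :: real assume "t \<in> {0..}"
  then have "p (t *\<^sub>R y) = t * p y" using assms by (simp add: sublinear_def)
  moreover have "p ((x + t *\<^sub>R y) + - x) \<le> p (x + t *\<^sub>R y) + p (- x)"
    using assms unfolding sublinear_def by blast
  ultimately show "- p (- x) \<le> p (x + t *\<^sub>R y) - t * p y" by simp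
qed

lemma ray_infimum_le:
  assumes "sublinear p" "t \<ge> 0"
  shows "ray_infimum p y x \<le> p (x + t *\<^sub>R y) - t * p y"
  unfolding ray_infimum_def using assms by (intro cINF_lower ray_infimum_bdd) auto

lemma ray_infimum_greatest:
  assumes "\<And>t. t \<ge> 0 \<Longrightarrow> c \<le> p (x + t *\<^sub>R y) - t * p y"
  shows "c \<le> ray_infimum p y x"
  unfolding ray_infimum_def using assms by (intro cINF_greatest) auto

lemma sublinear_ray_infimum:
  assumes p: "sublinear p"
  shows "sublinear (ray_infimum p y)"
  unfolding sublinear_def
proof (intro conjI allI impI)
  fix u v
  have *: "ray_infimum p y (u + v) \<le> (p (u + s *\<^sub>R y) - s * p y) + (p (v + t *\<^sub>R y) - t * p y)"
    if "s \<ge> 0" "t \<ge> 0" for s t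
  proof -
    have "ray_infimum p y (u + v) \<le> p ((u + v) + (s + t) *\<^sub>R y) - (s + t) * p y"
      using that by (intro ray_infimum_le p) auto
    also have "(u + v) + (s + t) *\<^sub>R y = (u + s *\<^sub>R y) + (v + t *\<^sub>R y)"
      by (simp add: algebra_simps)
    also have "p \<dots> \<le> p (u + s *\<^sub>R y) + p (v + t *\<^sub>R y)"
      using p unfolding sublinear_def by blast
    finally show ?thesis by (simp add: algebra_simps)
  qed
  have "ray_infimum p y (u + v) - (p (v + t *\<^sub>R y) - t * p y) \<le> ray_infimum p y u"
    if "t \<ge> 0" for t
    using *[OF _ that] by (intro ray_infimum_greatest) (smt (verit))
  then have "ray_infimum p y (u + v) - ray_infimum p y u \<le> ray_infimum p y v"
    by (intro ray_infimum_greatest) (smt (verit))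
  then show "ray_infimum p y (u + v) \<le> ray_infimum p y u + ray_infimum p y v" by simp
next
  fix c :: real and x assume c: "c \<ge> 0"
  show "ray_infimum p y (c *\<^sub>R x) = c * ray_infimum p y x"
  proof (cases "c = 0")
    case True
    have "ray_infimum p y 0 = 0"
    proof (rule antisym)
      show "ray_infimum p y 0 \<le> 0"
        using ray_infimum_le[OF p, of 0 y 0] sublinear_zero[OF p] by simp
      show "0 \<le> ray_infimum p y 0"
        using p by (intro ray_infimum_greatest) (simp add: sublinear_def)
    qed
    then show ?thesis using True by simp
  next
    case False
    with c have c: "c > 0" by simp
    have scale: "c * (p (x + t *\<^sub>R y) - t * p y) = p (c *\<^sub>R x + (c * t) *\<^sub>R y) - (c * t) * p y" for t
    proof -
      have "p (c *\<^sub>R (x + t *\<^sub>R y)) = c * p (x + t *\<^sub>R y)"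
        using p c unfolding sublinear_def by simp
      then show ?thesis by (simp add: algebra_simps)
    qed
    show ?thesis
    proof (rule antisym)
      have "ray_infimum p y (c *\<^sub>R x) / c \<le> ray_infimum p y x"
      proof (rule ray_infimum_greatest)
        fix t :: real assume "t \<ge> 0"
        then have "ray_infimum p y (c *\<^sub>R x) \<le> c * (p (x + t *\<^sub>R y) - t * p y)"
          unfolding scale using c by (intro ray_infimum_le p) auto
        then show "ray_infimum p y (c *\<^sub>R x) / c \<le> p (x + t *\<^sub>R y) - t * p y"
          using c by (simp add: field_simps)
      qed
      then show "ray_infimum p y (c *\<^sub>R x) \<le> c * ray_infimum p y x"
        using c by (simp add: field_simps)
      show "c * ray_infimum p y x \<le> ray_infimum p y (c *\<^sub>R x)"
      proof (rule ray_infimum_greatest)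
        fix t :: real assume "t \<ge> 0"
        then have "ray_infimum p y x \<le> p (x + (t / c) *\<^sub>R y) - (t / c) * p y"
          using c by (intro ray_infimum_le p) auto
        then have "c * ray_infimum p y x \<le> c * (p (x + (t / c) *\<^sub>R y) - (t / c) * p y)"
          using c by simp
        then show "c * ray_infimum p y x \<le> p (c *\<^sub>R x + t *\<^sub>R y) - t * p y"
          unfolding scale using c by simp
      qed
    qed
  qed
qed

text \<open>A minimal \<open>p\<close> equals its infimum along the ray through \<open>y\<close>. The member \<open>t = 1\<close> of that infimum
  gives \<open>p(x) + p(y) \<le> p(x + y)\<close>, the converse of subadditivity.\<close>

lemma minimal_sublinear_is_linear:
  assumes p: "sublinear p"
    and min: "\<And>q. sublinear q \<Longrightarrow> (\<And>x. q x \<le> p x) \<Longrightarrow> q = p"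
  shows "linear p"
proof -
  have add: "p (x + y) = p x + p y" for x y
  proof -
    have "ray_infimum p y = p"
      using ray_infimum_le[OF p, of 0] by (intro min sublinear_ray_infimum p) auto
    then have "p x \<le> p (x + y) - p y"
      using ray_infimum_le[OF p, of 1 y x] by simp
    then show ?thesis using p unfolding sublinear_def by (smt (verit))
  qed
  have neg: "p (- x) = - p x" for x
    using add[of x "- x"] sublinear_zero[OF p] by simp
  have "p (c *\<^sub>R x) = c * p x" for c x
  proof (cases "c \<ge> 0")
    case True
    then show ?thesis using p by (simp add: sublinear_def)
  next
    case False
    then have "p ((- c) *\<^sub>R x) = (- c) * p x" using p unfolding sublinear_def
      by (metis neg_0_le_iff_le nle_le)
    then show ?thesis using neg[of "c *\<^sub>R x"] by simp
  qed
  with add show ?thesis by (intro linearI) auto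
qed

text \<open>Subadditivity passes to the infimum because for any two members \<open>p\<close>, \<open>q\<close> of a chain the smaller
  one bounds the value at \<open>x + y\<close> by \<open>p(x) + q(y)\<close>. The function \<open>l\<close> keeps the infima finite.\<close>

lemma sublinear_chain_infimum:
  fixes C :: "('a::real_vector \<Rightarrow> real) set"
  assumes "C \<noteq> {}" and sub: "\<And>p. p \<in> C \<Longrightarrow> sublinear p"
    and chain: "\<And>p q. p \<in> C \<Longrightarrow> q \<in> C \<Longrightarrow> p \<le> q \<or> q \<le> p"
    and low: "\<And>p x. p \<in> C \<Longrightarrow> l x \<le> p x"
  shows "sublinear (\<lambda>x. INF p\<in>C. p x)" "p \<in> C \<Longrightarrow> (INF p\<in>C. p x) \<le> p x"
proof -
  have lower: "(INF p\<in>C. p x) \<le> p x" if "p \<in> C" for p x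
    using that low by (intro cINF_lower bdd_belowI2[where m = "l x"]) auto
  then show "p \<in> C \<Longrightarrow> (INF p\<in>C. p x) \<le> p x" .
  show "sublinear (\<lambda>x. INF p\<in>C. p x)"
    unfolding sublinear_def
  proof (intro conjI allI impI)
    fix x y
    have *: "(INF p\<in>C. p (x + y)) \<le> p x + q y" if pq: "p \<in> C" "q \<in> C" for p q
    proof -
      obtain r where r: "r \<in> C" "r \<le> p" "r \<le> q"
        using chain[OF pq] pq by blast
      have "(INF p\<in>C. p (x + y)) \<le> r (x + y)" by (rule lower[OF r(1)])
      also have "\<dots> \<le> r x + r y" using sub[OF r(1)] unfolding sublinear_def by blast
      also have "\<dots> \<le> p x + q y" using r(2,3) by (intro add_mono) (auto simp: le_fun_def)
      finally show ?thesis .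
    qed
    have "(INF p\<in>C. p (x + y)) - q y \<le> (INF p\<in>C. p x)" if "q \<in> C" for q
      using *[OF _ that] assms(1) by (intro cINF_greatest) (auto simp: algebra_simps)
    then have "(INF p\<in>C. p (x + y)) - (INF p\<in>C. p x) \<le> (INF p\<in>C. p y)"
      using assms(1) by (intro cINF_greatest) (auto simp: algebra_simps)
    then show "(INF p\<in>C. p (x + y)) \<le> (INF p\<in>C. p x) + (INF p\<in>C. p y)" by simp
  next
    fix c :: real and x assume c: "c \<ge> 0"
    have hom: "p (c *\<^sub>R x) = c * p x" if "p \<in> C" for p
      using sub[OF that] c by (simp add: sublinear_def)
    have "(INF p\<in>C. p (c *\<^sub>R x)) = (INF p\<in>C. c * p x)"
      using hom by (intro INF_cong) auto
    also have "\<dots> = c * (INF p\<in>C. p x)"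
    proof (cases "c = 0")
      case True then show ?thesis using assms(1) by simp
    next
      case False
      with c have c: "c > 0" by simp
      show ?thesis
      proof (rule antisym)
        have bdd: "bdd_below ((\<lambda>p. c * p x) ` C)"
          using low c by (intro bdd_belowI2[where m = "c * l x"]) auto
        have "(INF p\<in>C. c * p x) / c \<le> (INF p\<in>C. p x)"
        proof (intro cINF_greatest assms(1))
          fix p assume "p \<in> C"
          then have "(INF p\<in>C. c * p x) \<le> c * p x" by (rule cINF_lower[OF bdd])
          then show "(INF p\<in>C. c * p x) / c \<le> p x" using c by (simp add: field_simps)
        qed
        then show "(INF p\<in>C. c * p x) \<le> c * (INF p\<in>C. p x)"
          using c by (simp add: field_simps)
        show "c * (INF p\<in>C. p x) \<le> (INF p\<in>C. c * p x)"
          using lower c by (intro cINF_greatest assms(1)) auto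
      qed
    qed
    finally show "(INF p\<in>C. p (c *\<^sub>R x)) = c * (INF p\<in>C. p x)" .
  qed
qed

text \<open>The Hahn-Banach theorem in the form that Zorn's lemma yields most directly: a minimal sublinear
  function below \<open>p\<close> exists, and it is linear.\<close>

lemma linear_below_sublinear:
  fixes p :: "'a::real_vector \<Rightarrow> real"
  assumes p: "sublinear p"
  obtains f where "linear f" "\<And>x. f x \<le> p x"
proof -
  define A where "A = {q. sublinear q \<and> q \<le> p}"
  let ?P = "\<lambda>q r :: 'a \<Rightarrow> real. r \<le> q"
  \<comment> \<open>All members share this lower bound, so that pointwise infima of chains exist.\<close>
  have lowA: "- p (- x) \<le> q x" if "q \<in> A" for q x
  proof -
    have "q (- x) \<le> p (- x)" using that by (auto simp: A_def le_fun_def)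
    with sublinear_neg_lower[of q x] that show ?thesis by (auto simp: A_def)
  qed
  have "\<exists>m\<in>A. \<forall>a\<in>A. a \<le> m \<longrightarrow> a = m"
  proof (rule predicate_Zorn[where P = ?P])
    show "partial_order_on A (relation_of ?P A)"
      by (rule partial_order_on_relation_ofI) auto
    fix C assume C: "C \<in> Chains (relation_of ?P A)"
    then have CA: "C \<subseteq> A" by (auto simp: Chains_def relation_of_def)
    show "\<exists>u\<in>A. \<forall>a\<in>C. u \<le> a"
    proof (cases "C = {}")
      case True
      then show ?thesis using p by (auto simp: A_def)
    next
      case False
      have sub: "\<And>q. q \<in> C \<Longrightarrow> sublinear q" using CA by (auto simp: A_def)
      have chain: "q \<le> r \<or> r \<le> q" if "q \<in> C" "r \<in> C" for q r
        using C that by (auto simp: Chains_def relation_of_def)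
      have low: "- p (- x) \<le> q x" if "q \<in> C" for q x using lowA that CA by blast
      define u where "u = (\<lambda>x. INF q\<in>C. q x)"
      have "sublinear u" unfolding u_def
        by (rule sublinear_chain_infimum(1)[where l = "\<lambda>x. - p (- x)"]) (use False sub chain low in auto)
      moreover have le: "u \<le> q" if "q \<in> C" for q
        unfolding u_def le_fun_def
        by (intro allI sublinear_chain_infimum(2)[where l = "\<lambda>x. - p (- x)"])
          (use False sub chain low that in auto)
      moreover have "u \<le> p"
      proof -
        obtain q where "q \<in> C" using False by blast
        then show ?thesis using le[of q] CA by (auto simp: A_def)
      qed
      ultimately show ?thesis by (auto simp: A_def)
    qed
  qed
  then obtain m where m: "m \<in> A" "\<And>a. a \<in> A \<Longrightarrow> a \<le> m \<Longrightarrow> a = m" by blast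
  have "linear m"
  proof (rule minimal_sublinear_is_linear)
    show "sublinear m" using m(1) by (simp add: A_def)
    fix q assume q: "sublinear q" "\<And>x. q x \<le> m x"
    then have "q \<le> m" by (simp add: le_fun_def)
    with m(1) q(1) show "q = m" by (intro m(2)) (auto simp: A_def)
  qed
  with that show ?thesis using m(1) by (auto simp: A_def le_fun_def)
qed

text \<open>Domination by the infimum of the norm along the ray through \<open>d\<close> gives \<open>f(-d) \<le> -\<parallel>d\<parallel>\<close>.\<close>

lemma norming_functional:
  fixes d :: "'a::real_normed_vector"
  obtains f where "bounded_linear f" "\<And>x. \<bar>f x\<bar> \<le> norm x" "f d = norm d"
proof -
  have norm: "sublinear (norm :: 'a \<Rightarrow> real)"
    by (auto simp: sublinear_def norm_triangle_ineq)
  obtain f where f: "linear f" "\<And>x. f x \<le> ray_infimum norm d x"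
    using linear_below_sublinear[OF sublinear_ray_infimum[OF norm]] by blast
  have le: "f x \<le> norm x" for x
    using f(2)[of x] ray_infimum_le[OF norm, of 0 d x] by simp
  have abs: "\<bar>f x\<bar> \<le> norm x" for x
    using le[of x] le[of "- x"] linear_neg[OF f(1), of x] by simp
  have "f (- d) \<le> - norm d"
    using f(2)[of "- d"] ray_infimum_le[OF norm, of 1 d "- d"] by simp
  then have "f d = norm d"
    using linear_neg[OF f(1), of d] le[of d] by simp
  moreover have "bounded_linear f"
    using f(1) abs by (intro bounded_linear_intro[where K = 1]) (auto simp: linear_add linear_scale)
  ultimately show ?thesis using that abs by blast
qed

text \<open>Functionals that norm the points of a countable dense set determine every norm, because they are
  all Lipschitz with constant 1.\<close>

lemma norming_sequence:
  obtains F :: "nat \<Rightarrow> 'a::{real_normed_vector, second_countable_topology} \<Rightarrow> real"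
  where "\<And>n. bounded_linear (F n)" "\<And>n x. \<bar>F n x\<bar> \<le> norm x"
    "\<And>x r. (\<And>n. \<bar>F n x\<bar> \<le> r) \<Longrightarrow> norm x \<le> r"
proof -
  obtain D :: "'a set" where D: "countable D" "\<And>X. open X \<Longrightarrow> X \<noteq> {} \<Longrightarrow> \<exists>d\<in>D. d \<in> X"
    by (rule countable_dense_setE) blast
  have "D \<noteq> {}" using D(2)[of UNIV] by auto
  define d where "d = from_nat_into D"
  have "\<exists>f. bounded_linear f \<and> (\<forall>x. \<bar>f x\<bar> \<le> norm x) \<and> f (d n) = norm (d n)" for n
    by (rule norming_functional[of "d n"]) blast
  then obtain F where F: "\<And>n. bounded_linear (F n)" "\<And>n x. \<bar>F n x\<bar> \<le> norm x"
    "\<And>n. F n (d n) = norm (d n)" by metis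
  have "norm x \<le> r" if r: "\<And>n. \<bar>F n x\<bar> \<le> r" for x r
  proof (rule field_le_epsilon)
    fix e :: real assume "e > 0"
    then have "ball x (e / 2) \<noteq> {}" by simp
    then obtain n where n: "dist x (d n) < e / 2"
      using D(2)[of "ball x (e / 2)"] from_nat_into_surj[OF D(1)] unfolding d_def by fastforce
    have "norm x \<le> norm (d n) + dist x (d n)"
      by (metis dist_norm norm_triangle_sub)
    also have "norm (d n) = F n x + F n (d n - x)"
      using F(3)[of n] by (simp add: linear_diff[OF bounded_linear.linear[OF F(1)]])
    also have "F n (d n - x) \<le> dist x (d n)"
      using F(2)[of n "d n - x"] by (simp add: dist_norm norm_minus_commute)
    also have "F n x \<le> r" using r[of n] by simp
    finally show "norm x \<le> r + e" using n by simp
  qed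
  with F(1,2) that show ?thesis by blast
qed

section \<open>Uniqueness of characteristic functionals\<close>

lemma borel_measurable_bounded_linear:
  "bounded_linear f \<Longrightarrow> f \<in> borel_measurable borel"
  by (intro borel_measurable_continuous_onI linear_continuous_on)

text \<open>The index sets \<open>T\<close> are finite sets of conditions \<open>f x \<in> A\<close>, so that intersecting two
  generators means uniting their index sets. Closed balls are generated since a norming sequence
  represents them as countable intersections, and in a separable space every open set is a
  countable union of closed balls.\<close>

lemma borel_eq_sigma_functionals:
  "sets (borel :: 'a::{real_normed_vector, second_countable_topology} measure) =
   sigma_sets UNIV {{x. \<forall>(f, A)\<in>T. f x \<in> A} | T. finite T \<and> (\<forall>(f, A)\<in>T. bounded_linear f \<and> A \<in> sets (borel :: real measure))}"
  (is "_ = sigma_sets UNIV ?E")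
proof (rule antisym)
  have "?E \<subseteq> sets borel"
  proof safe
    fix T :: "(('a \<Rightarrow> real) \<times> real set) set"
    assume T: "finite T" "\<forall>(f, A)\<in>T. bounded_linear f \<and> A \<in> sets borel"
    have piece: "f -` A \<in> sets borel" if "(f, A) \<in> T" for f A
    proof -
      have "f \<in> borel_measurable borel" "A \<in> sets borel"
        using T(2) that by (auto intro: borel_measurable_bounded_linear)
      from measurable_sets[OF this] show ?thesis by simp
    qed
    have "{x. \<forall>(f, A)\<in>T. f x \<in> A} = (if T = {} then UNIV else (\<Inter>(f, A)\<in>T. f -` A))" by auto
    also have "\<dots> \<in> sets borel"
    proof (cases "T = {}")
      case False
      then have "(\<Inter>p\<in>T. case p of (f, A) \<Rightarrow> f -` A) \<in> sets borel"
        using T(1) piece by (intro sets.finite_INT) auto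
      then show ?thesis using False by simp
    qed simp
    finally show "{x. \<forall>(f, A)\<in>T. f x \<in> A} \<in> sets borel" .
  qed
  then show "sigma_sets UNIV ?E \<subseteq> sets borel"
    using sets.sigma_sets_subset[of ?E borel] by simp
next
  interpret S: sigma_algebra UNIV "sigma_sets UNIV ?E" by (rule sigma_algebra_sigma_sets) simp
  obtain F :: "nat \<Rightarrow> 'a \<Rightarrow> real" where F: "\<And>n. bounded_linear (F n)" "\<And>n x. \<bar>F n x\<bar> \<le> norm x"
    "\<And>x r. (\<And>n. \<bar>F n x\<bar> \<le> r) \<Longrightarrow> norm x \<le> r"
    by (rule norming_sequence) blast
  have cball: "cball c r \<in> sigma_sets UNIV ?E" for c r
  proof -
    have diff: "F n (c - x) = F n c - F n x" for n x
      by (simp add: linear_diff[OF bounded_linear.linear[OF F(1)]])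
    have "cball c r = (\<Inter>n. {x. F n x \<in> cball (F n c) r})"
    proof (intro set_eqI iffI)
      fix x assume "x \<in> cball c r"
      then show "x \<in> (\<Inter>n. {x. F n x \<in> cball (F n c) r})"
        using F(2)[of _ "c - x"] by (auto simp: dist_norm diff intro: order_trans)
    next
      fix x assume "x \<in> (\<Inter>n. {x. F n x \<in> cball (F n c) r})"
      then show "x \<in> cball c r"
        using F(3)[of "c - x" r] by (auto simp: dist_norm diff)
    qed
    moreover have "{x. F n x \<in> cball (F n c) r} \<in> ?E" for n
      using F(1) by (intro CollectI exI[of _ "{(F n, cball (F n c) r)}"]) auto
    ultimately show ?thesis by (auto intro!: S.countable_INT)
  qed
  obtain D :: "'a set" where D: "countable D" "\<And>X. open X \<Longrightarrow> X \<noteq> {} \<Longrightarrow> \<exists>d\<in>D. d \<in> X"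
    by (rule countable_dense_setE) blast
  have "S \<in> sigma_sets UNIV ?E" if "open S" for S :: "'a set"
  proof -
    define I where "I = {(d, q). d \<in> D \<and> q \<in> \<rat> \<and> cball d q \<subseteq> S}"
    have "I \<subseteq> D \<times> \<rat>" by (auto simp: I_def)
    then have "countable I" using D(1) countable_rat by (meson countable_SIGMA countable_subset)
    moreover have "S = (\<Union>(d, q)\<in>I. cball d q)"
    proof
      show "S \<subseteq> (\<Union>(d, q)\<in>I. cball d q)"
      proof
        fix x assume "x \<in> S"
        then obtain e where e: "e > 0" "ball x e \<subseteq> S" using \<open>open S\<close> openE by blast
        obtain d where d: "d \<in> D" "dist x d < e / 3"
          using D(2)[of "ball x (e / 3)"] e(1) by auto
        obtain q where q: "q \<in> \<rat>" "e / 3 < q" "q < e / 2"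
          using Rats_dense_in_real[of "e / 3" "e / 2"] e(1) by auto
        have "cball d q \<subseteq> ball x e"
        proof
          fix z assume "z \<in> cball d q"
          then show "z \<in> ball x e" using d q e(1) dist_triangle[of x z d] by simp
        qed
        then have "(d, q) \<in> I" using d q e by (auto simp: I_def)
        moreover have "x \<in> cball d q" using d q by (simp add: dist_commute)
        ultimately show "x \<in> (\<Union>(d, q)\<in>I. cball d q)" by blast
      qed
    qed (auto simp: I_def)
    moreover have "(\<Union>(d, q)\<in>I. cball d q) \<in> sigma_sets UNIV ?E"
      using \<open>countable I\<close> by (intro S.countable_UN') (use cball in auto)
    ultimately show ?thesis by simp
  qed
  then show "sets borel \<subseteq> sigma_sets UNIV ?E"
    by (subst sets_borel) (intro S.sigma_sets_subset, auto)
qed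

lemma integrable_bounded_weight:
  fixes h :: "'a::{real_normed_vector, second_countable_topology} \<Rightarrow> 'b::{banach, second_countable_topology}"
  assumes "finite_measure M" "sets M = sets borel" "h \<in> borel_measurable borel" "\<And>x. norm (h x) \<le> B"
  shows "integrable M h"
proof -
  interpret finite_measure M by fact
  have "h \<in> borel_measurable M" using assms(2,3) by (simp cong: measurable_cong_sets)
  then show ?thesis using assms(4) by (intro integrable_const_bound[where B = B]) auto
qed

text \<open>After normalization, a weight \<open>G\<close> turns integrals of \<open>G\<close> against functions of \<open>f\<close> into statements
  about a probability distribution on the line, to which Levy's uniqueness theorem applies.\<close>

lemma weighted_law:
  fixes G f :: "'a::{real_normed_vector, second_countable_topology} \<Rightarrow> real"
  assumes M: "finite_measure M" "sets M = sets borel"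
    and G: "G \<in> borel_measurable borel" "\<And>x. 0 \<le> G x" "\<And>x. G x \<le> B"
    and f: "f \<in> borel_measurable borel"
    and c: "c = (\<integral>x. G x \<partial>M)" "c > 0"
  defines "L \<equiv> distr (density M (\<lambda>x. G x / c)) borel f"
  shows "real_distribution L"
    and "char L t = (CLINT x|M. G x *\<^sub>R iexp (t * f x)) / c"
    and "A \<in> sets borel \<Longrightarrow> measure L A = (\<integral>x. G x * indicator A (f x) \<partial>M) / c"
proof -
  have [measurable_cong]: "sets M = sets borel" by (rule M)
  have [measurable]: "G \<in> borel_measurable borel" "f \<in> borel_measurable borel" using G f by auto
  have int: "integrable M G" using G by (intro integrable_bounded_weight[OF M, of _ B]) auto
  have "emeasure (density M (\<lambda>x. G x / c)) (space (density M (\<lambda>x. G x / c))) = (\<integral>\<^sup>+ x. ennreal (G x / c) \<partial>M)"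
    by (simp add: emeasure_density cong: nn_integral_cong)
  also have "\<dots> = ennreal (\<integral>x. G x / c \<partial>M)"
    using int G(2) c by (intro nn_integral_eq_integral) auto
  also have "\<dots> = 1" using c by simp
  finally have "prob_space (density M (\<lambda>x. G x / c))" by (rule prob_spaceI)
  then interpret P: prob_space "density M (\<lambda>x. G x / c)" .
  show L: "real_distribution L"
    unfolding L_def by (rule P.real_distribution_distr) simp
  have "char L t = (CLINT x|M. (G x / c) *\<^sub>R iexp (t * f x))"
    unfolding char_def L_def using G(2) c by (simp add: integral_distr integral_density)
  also have "\<dots> = (CLINT x|M. (1 / c) *\<^sub>R (G x *\<^sub>R iexp (t * f x)))" by simp
  also have "\<dots> = (1 / c) *\<^sub>R (CLINT x|M. G x *\<^sub>R iexp (t * f x))" by (rule integral_scaleR_right)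
  finally show "char L t = (CLINT x|M. G x *\<^sub>R iexp (t * f x)) / c"
    by (simp add: scaleR_conv_of_real)
  show "measure L A = (\<integral>x. G x * indicator A (f x) \<partial>M) / c" if A: "A \<in> sets borel"
  proof -
    interpret L: real_distribution L by (rule L)
    have "measure L A = (\<integral>y. indicator A y \<partial>L)" using A by simp
    also have "\<dots> = (\<integral>x. (G x / c) * indicator A (f x) \<partial>M)"
      unfolding L_def using G(2) c(2) A by (subst integral_distr) (simp_all add: integral_density)
    also have "\<dots> = (\<integral>x. G x * indicator A (f x) / c \<partial>M)" by simp
    finally show ?thesis by simp
  qed
qed

text \<open>The class of weights under which \<open>M\<close> and \<open>N\<close> cannot be told apart by characters. Nonnegativity is
  part of the definition because Levy's theorem concerns probability measures.\<close>

definition same_transform ::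
    "'a::real_normed_vector measure \<Rightarrow> 'a measure \<Rightarrow> ('a \<Rightarrow> real) \<Rightarrow> bool" where
  "same_transform M N G \<longleftrightarrow> G \<in> borel_measurable borel \<and> (\<forall>x. 0 \<le> G x) \<and> (\<exists>B. \<forall>x. G x \<le> B) \<and>
    (\<forall>g. bounded_linear g \<longrightarrow>
      (CLINT x|M. G x *\<^sub>R iexp (g x)) = (CLINT x|N. G x *\<^sub>R iexp (g x)))"

context
  fixes M N :: "'a::{real_normed_vector, second_countable_topology} measure"
  assumes M: "finite_measure M" "sets M = sets borel"
    and N: "finite_measure N" "sets N = sets borel"
begin

lemma same_transform_integral:
  assumes "same_transform M N G"
  shows "(\<integral>x. G x \<partial>M) = (\<integral>x. G x \<partial>N)"
proof -
  have "(CLINT x|M. G x *\<^sub>R iexp ((\<lambda>_. 0) x)) = (CLINT x|N. G x *\<^sub>R iexp ((\<lambda>_. 0) x))"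
    using assms bounded_linear_zero unfolding same_transform_def by blast
  then have "(CLINT x|M. complex_of_real (G x)) = (CLINT x|N. complex_of_real (G x))"
    by (simp add: scaleR_conv_of_real)
  then show ?thesis by simp
qed

text \<open>The characters \<open>iexp (t * f)\<close>, for real \<open>t\<close>, form the characteristic function of the law of \<open>f\<close>
  under the weight, so the two laws agree. A weight of total mass 0 has no normalized law, but then
  both integrals vanish.\<close>

lemma same_transform_level_set:
  fixes f :: "'a \<Rightarrow> real"
  assumes G: "same_transform M N G" and f: "bounded_linear f" and A: "A \<in> sets borel"
  shows "(\<integral>x. G x * indicator A (f x) \<partial>M) = (\<integral>x. G x * indicator A (f x) \<partial>N)"
proof -
  obtain B where G': "G \<in> borel_measurable borel" "\<And>x. 0 \<le> G x" "\<And>x. G x \<le> B"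
    using G unfolding same_transform_def by auto
  have fm [measurable]: "f \<in> borel_measurable borel" using f by (rule borel_measurable_bounded_linear)
  define c where "c = (\<integral>x. G x \<partial>M)"
  have c: "c = (\<integral>x. G x \<partial>M)" "c = (\<integral>x. G x \<partial>N)"
    using same_transform_integral[OF G] by (auto simp: c_def)
  have "c \<ge> 0" unfolding c(1) using G'(2) by simp
  then consider "c = 0" | "c > 0" by linarith
  then show ?thesis
  proof cases
    case 1
    have zero: "(\<integral>x. G x * indicator A (f x) \<partial>K) = 0"
      if K: "finite_measure K" "sets K = sets borel" and "(\<integral>x. G x \<partial>K) = 0" for K
    proof (rule antisym)
      have m: "(\<lambda>x. G x * indicator A (f x)) \<in> borel_measurable borel" using G'(1) A by measurable
      have "(\<integral>x. G x * indicator A (f x) \<partial>K) \<le> (\<integral>x. G x \<partial>K)"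
        using G' by (intro integral_mono integrable_bounded_weight[OF K, of _ B] m)
          (auto simp: indicator_def intro: order_trans)
      then show "(\<integral>x. G x * indicator A (f x) \<partial>K) \<le> 0" using that by simp
      show "0 \<le> (\<integral>x. G x * indicator A (f x) \<partial>K)" using G'(2) by simp
    qed
    show ?thesis using zero[OF M] zero[OF N] c 1 by simp
  next
    case 2
    note lM = weighted_law[where M = M and G = G and f = f and c = c and B = B, OF M G' fm c(1) 2]
      and lN = weighted_law[where M = N and G = G and f = f and c = c and B = B, OF N G' fm c(2) 2]
    have "char (distr (density M (\<lambda>x. G x / c)) borel f) = char (distr (density N (\<lambda>x. G x / c)) borel f)"
    proof
      fix t
      have "bounded_linear (\<lambda>x. t * f x)"
        using f by (rule bounded_linear_const_mult)
      then have "(CLINT x|M. G x *\<^sub>R iexp (t * f x)) = (CLINT x|N. G x *\<^sub>R iexp (t * f x))"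
        using G unfolding same_transform_def by blast
      then show "char (distr (density M (\<lambda>x. G x / c)) borel f) t = char (distr (density N (\<lambda>x. G x / c)) borel f) t"
        by (simp only: lM(2) lN(2))
    qed
    then have "distr (density M (\<lambda>x. G x / c)) borel f = distr (density N (\<lambda>x. G x / c)) borel f"
      by (intro Levy_uniqueness lM(1) lN(1))
    then show ?thesis using lM(3)[OF A] lN(3)[OF A] 2 by simp
  qed
qed

text \<open>Multiplication by a trigonometric polynomial in \<open>h\<close> only shifts the character \<open>iexp g\<close> to
  \<open>iexp (g + h)\<close> and \<open>iexp (g - h)\<close>, against which \<open>G\<close> has equal integrals by assumption.\<close>

lemma same_transform_combination:
  fixes a b :: complex
  assumes G: "same_transform M N G" and h: "bounded_linear h"
    and H: "H \<in> borel_measurable borel" "\<And>x. 0 \<le> H x" "\<And>x. H x \<le> 2 * G x"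
    and eq: "\<And>x. complex_of_real (H x) = G x *\<^sub>R (1 + a * iexp (h x) + b * iexp (- h x))"
  shows "same_transform M N H"
proof -
  obtain B where G': "G \<in> borel_measurable borel" "\<And>x. 0 \<le> G x" "\<And>x. G x \<le> B"
    using G unfolding same_transform_def by auto
  have "(CLINT x|M. H x *\<^sub>R iexp (g x)) = (CLINT x|N. H x *\<^sub>R iexp (g x))"
    if g: "bounded_linear g" for g
  proof -
    let ?I = "\<lambda>K g. (CLINT x|K. G x *\<^sub>R iexp (g x))"
    have lin: "bounded_linear (\<lambda>x. g x + h x)" "bounded_linear (\<lambda>x. g x - h x)"
      using g h by (auto intro: bounded_linear_add bounded_linear_sub)
    have expand: "H x *\<^sub>R iexp (g x) = G x *\<^sub>R iexp (g x)
        + a * (G x *\<^sub>R iexp (g x + h x)) + b * (G x *\<^sub>R iexp (g x - h x))" for x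
    proof -
      have "H x *\<^sub>R iexp (g x) = complex_of_real (H x) * iexp (g x)" by (simp add: scaleR_conv_of_real)
      also have "\<dots> = G x *\<^sub>R iexp (g x) + a * (G x *\<^sub>R (iexp (h x) * iexp (g x)))
          + b * (G x *\<^sub>R (iexp (- h x) * iexp (g x)))"
        unfolding eq by (simp add: scaleR_conv_of_real algebra_simps)
      also have "iexp (h x) * iexp (g x) = iexp (g x + h x)"
        by (simp add: exp_add [symmetric] algebra_simps)
      also have "iexp (- h x) * iexp (g x) = iexp (g x - h x)"
        by (simp add: exp_add [symmetric] algebra_simps)
      finally show ?thesis .
    qed
    have split: "(CLINT x|K. H x *\<^sub>R iexp (g x)) = ?I K g + a * ?I K (\<lambda>x. g x + h x) + b * ?I K (\<lambda>x. g x - h x)"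
      if K: "finite_measure K" "sets K = sets borel" for K
    proof -
      have int: "integrable K (\<lambda>x. G x *\<^sub>R iexp (k x))" if "bounded_linear k" for k
      proof (rule integrable_bounded_weight[OF K, of _ B])
        have [measurable]: "k \<in> borel_measurable borel" using that by (rule borel_measurable_bounded_linear)
        show "(\<lambda>x. G x *\<^sub>R iexp (k x)) \<in> borel_measurable borel" using G'(1) by measurable
        show "norm (G x *\<^sub>R iexp (k x)) \<le> B" for x using G'(2,3)[of x] by simp
      qed
      note i1 = int[OF g] and i2 = Bochner_Integration.integrable_mult_right[of a, OF int[OF lin(1)]]
        and i3 = Bochner_Integration.integrable_mult_right[of b, OF int[OF lin(2)]]
      show ?thesis
        unfolding expand Bochner_Integration.integral_add[OF Bochner_Integration.integrable_add[OF i1 i2] i3]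
          Bochner_Integration.integral_add[OF i1 i2] integral_mult_right_zero ..
    qed
    have "?I M k = ?I N k" if "bounded_linear k" for k
      using G that unfolding same_transform_def by blast
    from this[OF g] this[OF lin(1)] this[OF lin(2)] show ?thesis
      unfolding split[OF M] split[OF N] by (simp only:)
  qed
  moreover have "H x \<le> 2 * B" for x using H(3)[of x] G'(3)[of x] by linarith
  ultimately show ?thesis unfolding same_transform_def using H(1,2) by blast
qed

lemma same_transform_cos_sin:
  assumes G: "same_transform M N G" and h: "bounded_linear h"
  shows "same_transform M N (\<lambda>x. G x * (1 + cos (h x)))" "same_transform M N (\<lambda>x. G x * (1 + sin (h x)))"
proof -
  have [measurable]: "h \<in> borel_measurable borel" using h by (rule borel_measurable_bounded_linear)
  have [measurable]: "G \<in> borel_measurable borel" and G0: "\<And>x. 0 \<le> G x"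
    using G unfolding same_transform_def by auto
  have low: "0 \<le> 1 + cos y" "0 \<le> 1 + sin y" for y :: real
    using cos_ge_minus_one[of y] sin_ge_minus_one[of y] by linarith+
  have up: "1 + cos y \<le> 2" "1 + sin y \<le> 2" for y :: real by simp_all
  have iexp: "iexp y = complex_of_real (cos y) + \<i> * complex_of_real (sin y)"
    "iexp (- y) = complex_of_real (cos y) - \<i> * complex_of_real (sin y)" for y
    unfolding cis_conv_exp [symmetric] by (simp_all add: complex_eq_iff)
  show "same_transform M N (\<lambda>x. G x * (1 + cos (h x)))"
  proof (rule same_transform_combination[OF G h, where a = "1 / 2" and b = "1 / 2"])
    show "G x * (1 + cos (h x)) \<le> 2 * G x" for x
      using mult_left_mono[OF up(1) G0] by (simp add: mult.commute)
    show "complex_of_real (G x * (1 + cos (h x)))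
        = G x *\<^sub>R (1 + 1 / 2 * iexp (h x) + 1 / 2 * iexp (- h x))" for x
      unfolding iexp by (simp add: complex_eq_iff)
  qed (use G0 low in auto)
  show "same_transform M N (\<lambda>x. G x * (1 + sin (h x)))"
  proof (rule same_transform_combination[OF G h, where a = "- \<i> / 2" and b = "\<i> / 2"])
    show "G x * (1 + sin (h x)) \<le> 2 * G x" for x
      using mult_left_mono[OF up(2) G0] by (simp add: mult.commute)
    show "complex_of_real (G x * (1 + sin (h x)))
        = G x *\<^sub>R (1 + - \<i> / 2 * iexp (h x) + \<i> / 2 * iexp (- h x))" for x
      unfolding iexp by (simp add: complex_eq_iff)
  qed (use G0 low in auto)
qed

text \<open>The level set statement cannot be applied to the complex weight \<open>G * iexp g\<close>. It can be applied to
  the nonnegative weights \<open>G * (1 + cos g)\<close>, \<open>G * (1 + sin g)\<close> and \<open>G\<close>, whose differences are the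
  real and imaginary parts of \<open>G * iexp g\<close>. This makes restriction to a level set iterable, one
  functional at a time.\<close>

lemma same_transform_restrict:
  fixes f :: "'a \<Rightarrow> real"
  assumes G: "same_transform M N G" and f: "bounded_linear f" and A: "A \<in> sets borel"
  shows "same_transform M N (\<lambda>x. G x * indicator A (f x))"
proof -
  obtain B where G': "G \<in> borel_measurable borel" "\<And>x. 0 \<le> G x" "\<And>x. G x \<le> B"
    using G unfolding same_transform_def by auto
  note [measurable] = G'(1) A
  have [measurable]: "f \<in> borel_measurable borel" using f by (rule borel_measurable_bounded_linear)
  let ?H = "\<lambda>x. G x * indicator A (f x)"
  have H: "0 \<le> ?H x" "?H x \<le> B" for x
    using G'(2,3)[of x] by (auto simp: indicator_def intro: order_trans)
  have "(CLINT x|M. ?H x *\<^sub>R iexp (g x)) = (CLINT x|N. ?H x *\<^sub>R iexp (g x))"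
    if g: "bounded_linear g" for g
  proof -
    have [measurable]: "g \<in> borel_measurable borel" using g by (rule borel_measurable_bounded_linear)
    have split: "(CLINT x|K. ?H x *\<^sub>R iexp (g x)) =
        complex_of_real ((\<integral>x. G x * (1 + cos (g x)) * indicator A (f x) \<partial>K) - (\<integral>x. ?H x \<partial>K))
        + \<i> * complex_of_real ((\<integral>x. G x * (1 + sin (g x)) * indicator A (f x) \<partial>K) - (\<integral>x. ?H x \<partial>K))"
      if K: "finite_measure K" "sets K = sets borel" for K
    proof -
      have intH: "integrable K ?H"
        using H by (intro integrable_bounded_weight[OF K, of _ B]) auto
      have intu: "integrable K (\<lambda>x. ?H x * u (g x))"
        if "u \<in> borel_measurable borel" "\<And>y. \<bar>u y\<bar> \<le> 1" for u :: "real \<Rightarrow> real"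
      proof (rule integrable_bounded_weight[OF K, of _ B])
        note [measurable] = that(1)
        show "(\<lambda>x. ?H x * u (g x)) \<in> borel_measurable borel" by measurable
        show "norm (?H x * u (g x)) \<le> B" for x
          using mult_mono[OF H(2)[of x] that(2)[of "g x"]] H[of x] G'(2)[of x]
          by (simp add: abs_mult abs_of_nonneg)
      qed
      have cs: "integrable K (\<lambda>x. ?H x * cos (g x))" "integrable K (\<lambda>x. ?H x * sin (g x))"
        by (intro intu; simp)+
      have part: "(\<integral>x. G x * (1 + u (g x)) * indicator A (f x) \<partial>K) - (\<integral>x. ?H x \<partial>K) = (\<integral>x. ?H x * u (g x) \<partial>K)"
        if "integrable K (\<lambda>x. ?H x * u (g x))" for u :: "real \<Rightarrow> real"
        using Bochner_Integration.integral_add[OF intH that] by (simp add: algebra_simps)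
      have "(CLINT x|K. ?H x *\<^sub>R iexp (g x)) =
          (CLINT x|K. complex_of_real (?H x * cos (g x)) + \<i> * complex_of_real (?H x * sin (g x)))"
        by (intro Bochner_Integration.integral_cong refl)
          (simp add: cis_conv_exp [symmetric] complex_eq_iff)
      also have "\<dots> = complex_of_real (\<integral>x. ?H x * cos (g x) \<partial>K) + \<i> * complex_of_real (\<integral>x. ?H x * sin (g x) \<partial>K)"
        using cs by (subst Bochner_Integration.integral_add) (auto simp del: of_real_mult)
      finally show ?thesis unfolding part[OF cs(1)] part[OF cs(2)] .
    qed
    show ?thesis
      unfolding split[OF M] split[OF N]
      using same_transform_level_set[OF _ f A] G same_transform_cos_sin[OF G g] by simp
  qed
  then show ?thesis
    unfolding same_transform_def using H by (intro conjI allI exI[of _ B]) auto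
qed

end

text \<open>Starting from the weight 1 and restricting to level sets one after the other shows that the two
  measures agree on an intersection-stable generator of the Borel sets.\<close>

theorem measure_eqI_characteristic_functional:
  fixes M N :: "'a::{real_normed_vector, second_countable_topology} measure"
  assumes M: "finite_measure M" "sets M = sets borel"
    and N: "finite_measure N" "sets N = sets borel"
    and eq: "\<And>g. bounded_linear g \<Longrightarrow> (CLINT x|M. iexp (g x)) = (CLINT x|N. iexp (g x))"
  shows "M = N"
proof (rule measure_eqI_generator_eq[where \<Omega> = UNIV])
  let ?E = "{{x :: 'a. \<forall>(f, A)\<in>T. f x \<in> A} | T. finite T \<and> (\<forall>(f, A)\<in>T. bounded_linear f \<and> A \<in> sets (borel :: real measure))}"
  show "Int_stable ?E"
  proof (rule Int_stableI)
    fix a b assume "a \<in> ?E" "b \<in> ?E"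
    then obtain T U :: "(('a \<Rightarrow> real) \<times> real set) set" where "a = {x. \<forall>(f, A)\<in>T. f x \<in> A}" "finite T" "\<forall>(f, A)\<in>T. bounded_linear f \<and> A \<in> sets borel"
      "b = {x. \<forall>(f, A)\<in>U. f x \<in> A}" "finite U" "\<forall>(f, A)\<in>U. bounded_linear f \<and> A \<in> sets borel"
      by blast
    then show "a \<inter> b \<in> ?E" by (intro CollectI exI[of _ "T \<union> U"]) auto
  qed
  show "?E \<subseteq> Pow UNIV" by simp
  show "sets M = sigma_sets UNIV ?E" "sets N = sigma_sets UNIV ?E"
    using M(2) N(2) borel_eq_sigma_functionals by auto
  have transform: "same_transform M N (\<lambda>x. indicator {x. \<forall>(f, A)\<in>T. f x \<in> A} x)"
    if "finite T" "\<forall>(f, A)\<in>T. bounded_linear f \<and> A \<in> sets (borel :: real measure)"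
    for T :: "(('a \<Rightarrow> real) \<times> real set) set"
    using that
  proof (induction T rule: finite_induct)
    case empty
    then show ?case using eq by (auto simp: same_transform_def)
  next
    case (insert p T)
    obtain f A where p: "p = (f, A)" by (cases p)
    have "same_transform M N (\<lambda>x. indicator {x. \<forall>(f, A)\<in>T. f x \<in> A} x * indicator A (f x))"
      using insert p by (intro same_transform_restrict[OF M N]) auto
    also have "(\<lambda>x. indicator {x. \<forall>(f, A)\<in>T. f x \<in> A} x * indicator A (f x) :: real)
        = (\<lambda>x. indicator {x. \<forall>(f, A)\<in>insert p T. f x \<in> A} x)"
      by (auto simp: p indicator_def)
    finally show ?case .
  qed
  fix X assume "X \<in> ?E"
  then obtain T :: "(('a \<Rightarrow> real) \<times> real set) set" where T: "X = {x. \<forall>(f, A)\<in>T. f x \<in> A}" "finite T"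
    "\<forall>(f, A)\<in>T. bounded_linear f \<and> A \<in> sets (borel :: real measure)" by blast
  have "X \<in> sets borel" by (subst borel_eq_sigma_functionals) (rule sigma_sets.Basic[OF \<open>X \<in> ?E\<close>])
  then have X: "X \<in> sets M" "X \<in> sets N" using M(2) N(2) by auto
  interpret M: finite_measure M by (rule M)
  interpret N: finite_measure N by (rule N)
  have "(\<integral>x. indicator X x \<partial>M) = ((\<integral>x. indicator X x \<partial>N) :: real)"
    using same_transform_integral[OF M N transform[OF T(2,3)]] unfolding T(1) .
  then show "emeasure M X = emeasure N X"
    using X by (simp add: M.emeasure_eq_measure N.emeasure_eq_measure)
next
  show "range (\<lambda>_::nat. UNIV) \<subseteq> {{x :: 'a. \<forall>(f, A)\<in>T. f x \<in> A} | T. finite T \<and> (\<forall>(f, A)\<in>T. bounded_linear f \<and> A \<in> sets (borel :: real measure))}"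
    by (auto intro!: exI[of _ "{}"])
  show "emeasure M UNIV \<noteq> \<infinity>" for i :: nat
    using finite_measure.emeasure_finite[OF M(1)] by simp
qed simp

section \<open>Anderson's inequality from rotation invariance\<close>

text \<open>An orthogonal involution of the plane with coefficients in the vector space. Under the square
  of a centred Gaussian measure its two components are again independent with the same law.\<close>

definition rotation :: "'a::real_vector \<times> 'a \<Rightarrow> 'a \<times> 'a" where
  "rotation z = ((1 / sqrt 2) *\<^sub>R (fst z + snd z), (1 / sqrt 2) *\<^sub>R (fst z - snd z))"

locale rotation_invariant_measure = finite_measure \<nu>
  for \<nu> :: "'a::{real_normed_vector, second_countable_topology} measure" +
  assumes sets_eq_borel [measurable_cong, simp]: "sets \<nu> = sets borel"
    and rotation_invariant: "distr (\<nu> \<Otimes>\<^sub>M \<nu>) (\<nu> \<Otimes>\<^sub>M \<nu>) rotation = \<nu> \<Otimes>\<^sub>M \<nu>"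

definition cylinder_box :: "(nat \<Rightarrow> 'a \<Rightarrow> real) \<Rightarrow> nat \<Rightarrow> (nat \<Rightarrow> real) \<Rightarrow> (nat \<Rightarrow> real) \<Rightarrow> 'a set" where
  "cylinder_box f n y r = {x. \<forall>j<n. \<bar>f j x - y j\<bar> \<le> r j}"

lemma cylinder_box_sets:
  fixes f :: "nat \<Rightarrow> 'a::{real_normed_vector, second_countable_topology} \<Rightarrow> real"
  assumes "\<And>j. bounded_linear (f j)"
  shows "cylinder_box f n y r \<in> sets borel"
proof -
  have [measurable]: "f j \<in> borel_measurable borel" for j
    using assms by (rule borel_measurable_bounded_linear)
  show ?thesis unfolding cylinder_box_def by measurable
qed

lemma rotation_measurable [measurable]:
  "(rotation :: 'a::{real_normed_vector, second_countable_topology} \<times> 'a \<Rightarrow> 'a \<times> 'a)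
     \<in> measurable (borel \<Otimes>\<^sub>M borel) (borel \<Otimes>\<^sub>M borel)"
  unfolding rotation_def by measurable

text \<open>If \<open>(x, x')\<close> is the rotation of \<open>(u, v)\<close>, then \<open>x\<close> and \<open>x'\<close> both lie in the same interval
  around \<open>y\<close> exactly if \<open>u\<close> lies in an interval around \<open>\<surd>2 y\<close> whose radius shrinks with \<open>v\<close>. Only
  the centre for \<open>u\<close> depends on \<open>y\<close>.\<close>

lemma rotated_interval_iff:
  fixes a b y r :: real
  shows "\<bar>(a + b) / sqrt 2 - y\<bar> \<le> r \<and> \<bar>(a - b) / sqrt 2 - y\<bar> \<le> r
    \<longleftrightarrow> \<bar>a - sqrt 2 * y\<bar> \<le> sqrt 2 * r - \<bar>b\<bar>"
proof -
  have "\<bar>c / sqrt 2 - y\<bar> \<le> r \<longleftrightarrow> \<bar>c - sqrt 2 * y\<bar> \<le> sqrt 2 * r" for c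
  proof -
    have "\<bar>c / sqrt 2 - y\<bar> = \<bar>c - sqrt 2 * y\<bar> / sqrt 2"
    proof -
      have "c / sqrt 2 - y = (c - sqrt 2 * y) / sqrt 2" by (simp add: diff_divide_distrib)
      then show ?thesis by simp
    qed
    then show ?thesis by (simp add: field_simps)
  qed
  then show ?thesis by (simp add: abs_le_iff) linarith
qed

context rotation_invariant_measure
begin

lemma space_eq [simp]: "space \<nu> = UNIV"
  using sets_eq_imp_space_eq[OF sets_eq_borel] by simp

context
  fixes f :: "nat \<Rightarrow> 'a \<Rightarrow> real" and n :: nat
  assumes lin: "\<And>j. bounded_linear (f j)"
begin

lemma cylinder_box_sets' [measurable, simp]: "cylinder_box f n y r \<in> sets borel"
  using lin by (rule cylinder_box_sets)

text \<open>The mass of the square of a box under the product measure, computed after the rotation and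
  sliced at fixed second component \<open>v\<close>. Where \<open>|f\<^sub>j(v)| > \<surd>2 r\<^sub>j\<close> for some \<open>j\<close>, a radius is negative
  and the box is empty.\<close>

lemma box_mass_square:
  shows "emeasure \<nu> (cylinder_box f n y r) ^ 2 =
      (\<integral>\<^sup>+ v. emeasure \<nu> (cylinder_box f n (\<lambda>j. sqrt 2 * y j) (\<lambda>j. sqrt 2 * r j - \<bar>f j v\<bar>)) \<partial>\<nu>)" (is ?eq)
    and "(\<lambda>v. emeasure \<nu> (cylinder_box f n (\<lambda>j. sqrt 2 * y j) (\<lambda>j. sqrt 2 * r j - \<bar>f j v\<bar>)))
      \<in> borel_measurable \<nu>" (is ?meas)
proof -
  interpret P: pair_sigma_finite \<nu> \<nu> ..
  let ?S = "cylinder_box f n y r"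
  define Q where "Q = rotation -` (?S \<times> ?S) \<inter> space (\<nu> \<Otimes>\<^sub>M \<nu>)"
  have S: "?S \<in> sets \<nu>" by simp
  have SS: "?S \<times> ?S \<in> sets (\<nu> \<Otimes>\<^sub>M \<nu>)" using S by (intro pair_measureI)
  have rot: "rotation \<in> measurable (\<nu> \<Otimes>\<^sub>M \<nu>) (\<nu> \<Otimes>\<^sub>M \<nu>)"
    using rotation_measurable by (simp cong: measurable_cong_sets sets_pair_measure_cong)
  have Q: "Q \<in> sets (\<nu> \<Otimes>\<^sub>M \<nu>)"
    unfolding Q_def using rot SS by (rule measurable_sets)
  have sec: "(\<lambda>u. (u, v)) -` Q = cylinder_box f n (\<lambda>j. sqrt 2 * y j) (\<lambda>j. sqrt 2 * r j - \<bar>f j v\<bar>)" for v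
  proof -
    have "f j ((1 / sqrt 2) *\<^sub>R (u + v)) = (f j u + f j v) / sqrt 2"
      "f j ((1 / sqrt 2) *\<^sub>R (u - v)) = (f j u - f j v) / sqrt 2" for j u
      using bounded_linear.linear[OF lin[of j]]
      by (simp_all add: linear_add linear_diff linear_scale add_divide_distrib diff_divide_distrib)
    then show ?thesis
      unfolding Q_def rotation_def cylinder_box_def
      by (auto simp: space_pair_measure rotated_interval_iff [symmetric])
  qed
  have "emeasure \<nu> ?S ^ 2 = emeasure (\<nu> \<Otimes>\<^sub>M \<nu>) (?S \<times> ?S)"
    using S by (simp add: emeasure_pair_measure_Times power2_eq_square)
  also have "\<dots> = emeasure (distr (\<nu> \<Otimes>\<^sub>M \<nu>) (\<nu> \<Otimes>\<^sub>M \<nu>) rotation) (?S \<times> ?S)"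
    by (simp add: rotation_invariant)
  also have "\<dots> = emeasure (\<nu> \<Otimes>\<^sub>M \<nu>) Q"
    unfolding Q_def using rot SS by (rule emeasure_distr)
  also have "\<dots> = (\<integral>\<^sup>+ v. emeasure \<nu> ((\<lambda>u. (u, v)) -` Q) \<partial>\<nu>)"
    by (rule P.emeasure_pair_measure_alt2[OF Q])
  finally show ?eq by (simp add: sec)
  show ?meas using P.measurable_emeasure_Pair2[OF Q] by (simp add: sec)
qed

abbreviation "mass y r \<equiv> measure \<nu> (cylinder_box f n y r)"

abbreviation "zero \<equiv> (\<lambda>_::nat. 0::real)"

text \<open>The slice at \<open>v\<close> is empty unless \<open>v\<close> lies in the centred box of radius \<open>\<surd>2 r\<close>, and it is
  contained in the box of radius \<open>\<surd>2 r\<close> around \<open>\<surd>2 y\<close>.\<close>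

lemma mass_square_le:
  "mass y r ^ 2 \<le> mass (\<lambda>j. sqrt 2 * y j) (\<lambda>j. sqrt 2 * r j) * mass zero (\<lambda>j. sqrt 2 * r j)"
proof -
  let ?A = "cylinder_box f n (\<lambda>j. sqrt 2 * y j) (\<lambda>j. sqrt 2 * r j)"
  let ?B = "cylinder_box f n zero (\<lambda>j. sqrt 2 * r j)"
  have "emeasure \<nu> (cylinder_box f n (\<lambda>j. sqrt 2 * y j) (\<lambda>j. sqrt 2 * r j - \<bar>f j v\<bar>))
      \<le> emeasure \<nu> ?A * indicator ?B v" for v
  proof (cases "v \<in> ?B")
    case True
    have "cylinder_box f n (\<lambda>j. sqrt 2 * y j) (\<lambda>j. sqrt 2 * r j - \<bar>f j v\<bar>) \<subseteq> ?A"
      unfolding cylinder_box_def by (rule Collect_mono) (smt (verit))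
    then have "emeasure \<nu> (cylinder_box f n (\<lambda>j. sqrt 2 * y j) (\<lambda>j. sqrt 2 * r j - \<bar>f j v\<bar>)) \<le> emeasure \<nu> ?A"
      by (rule emeasure_mono) simp
    with True show ?thesis by simp
  next
    case False
    then obtain j where j: "j < n" "sqrt 2 * r j - \<bar>f j v\<bar> < 0"
      by (auto simp: cylinder_box_def not_le)
    have "x \<notin> cylinder_box f n (\<lambda>j. sqrt 2 * y j) (\<lambda>j. sqrt 2 * r j - \<bar>f j v\<bar>)" for x
      using j abs_ge_zero[of "f j x - sqrt 2 * y j"] unfolding cylinder_box_def by fastforce
    then have "cylinder_box f n (\<lambda>j. sqrt 2 * y j) (\<lambda>j. sqrt 2 * r j - \<bar>f j v\<bar>) = {}" by blast
    then show ?thesis by simp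
  qed
  then have "emeasure \<nu> (cylinder_box f n y r) ^ 2 \<le> (\<integral>\<^sup>+ v. emeasure \<nu> ?A * indicator ?B v \<partial>\<nu>)"
    unfolding box_mass_square(1) by (intro nn_integral_mono)
  also have "\<dots> = emeasure \<nu> ?A * emeasure \<nu> ?B"
    by (simp add: nn_integral_cmult_indicator)
  finally show ?thesis
    by (simp add: emeasure_eq_measure ennreal_mult [symmetric] ennreal_power)
qed

text \<open>The self-improving step: the assumed bound applies to each slice, and the integral of the centred
  slices is the square of the mass of the centred box.\<close>

lemma mass_sqrt_ratio:
  assumes "S \<ge> 0" and "\<And>y r. mass y r \<le> S * mass zero r"
  shows "mass y r \<le> sqrt S * mass zero r"
proof -
  have "emeasure \<nu> (cylinder_box f n y r) ^ 2 \<le> (\<integral>\<^sup>+ v. ennreal S *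
      emeasure \<nu> (cylinder_box f n (\<lambda>j. sqrt 2 * zero j) (\<lambda>j. sqrt 2 * r j - \<bar>f j v\<bar>)) \<partial>\<nu>)"
    unfolding box_mass_square(1) using assms
    by (intro nn_integral_mono) (simp add: emeasure_eq_measure ennreal_mult [symmetric])
  also have "\<dots> = ennreal S * emeasure \<nu> (cylinder_box f n zero r) ^ 2"
    unfolding box_mass_square(1) by (intro nn_integral_cmult box_mass_square(2))
  finally have "mass y r ^ 2 \<le> S * mass zero r ^ 2"
    using assms(1) by (simp add: emeasure_eq_measure ennreal_mult [symmetric] ennreal_power)
  then have "mass y r \<le> sqrt (S * mass zero r ^ 2)" by (rule real_le_rsqrt)
  then show ?thesis by (simp add: real_sqrt_mult)
qed

lemma mass_covering:
  assumes "\<And>y. mass y r \<le> a"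
  shows "mass y (\<lambda>j. sqrt 2 * r j) \<le> 2 ^ n * a"
proof -
  \<comment> \<open>In coordinate \<open>j\<close> the interval of radius \<open>\<surd>2 r\<close> is the union of two intervals of radius \<open>r\<close>,
    moved by \<open>(\<surd>2 - 1) r\<close> to either side; \<open>T\<close> records the coordinates moved upwards.\<close>
  define c where "c T j = y j + (if j \<in> T then 1 else -1) * ((sqrt 2 - 1) * r j)" for T :: "nat set" and j
  have "cylinder_box f n y (\<lambda>j. sqrt 2 * r j) \<subseteq> (\<Union>T\<in>Pow {..<n}. cylinder_box f n (c T) r)"
  proof
    fix x assume x: "x \<in> cylinder_box f n y (\<lambda>j. sqrt 2 * r j)"
    define T where "T = {j\<in>{..<n}. f j x \<ge> y j}"
    have "\<bar>f j x - c T j\<bar> \<le> r j" if "j < n" for j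
    proof -
      have *: "\<bar>f j x - y j\<bar> \<le> sqrt 2 * r j" using x that by (simp add: cylinder_box_def)
      then have r: "r j \<ge> 0" by (smt (verit) mult_neg_pos mult_pos_neg real_sqrt_gt_zero)
      have "sqrt 2 \<le> 2" by (simp add: real_le_lsqrt)
      then have "sqrt 2 * r j \<le> 2 * r j" "r j \<le> sqrt 2 * r j"
        using r by (auto intro: mult_right_mono simp: mult_le_cancel_right1)
      then show ?thesis using * that by (auto simp: c_def T_def algebra_simps)
    qed
    then show "x \<in> (\<Union>T\<in>Pow {..<n}. cylinder_box f n (c T) r)"
      by (intro UN_I[of T]) (auto simp: cylinder_box_def T_def)
  qed
  then have "mass y (\<lambda>j. sqrt 2 * r j) \<le> measure \<nu> (\<Union>T\<in>Pow {..<n}. cylinder_box f n (c T) r)"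
    by (intro finite_measure_mono) auto
  also have "\<dots> \<le> (\<Sum>T\<in>Pow {..<n}. mass (c T) r)"
    by (intro finite_measure_subadditive_finite) auto
  also have "\<dots> \<le> (\<Sum>T\<in>Pow {..<n}. a)"
    by (intro sum_mono assms)
  finally show ?thesis by (simp add: card_Pow)
qed

text \<open>Let \<open>a(r)\<close> be the supremum over all centres and \<open>b(r)\<close> the mass of the centred box. For
  \<open>r = \<surd>2 r'\<close>, \<open>a(r')\<^sup>2 \<le> a(r) b(r) \<le> 2\<^sup>n a(r') b(r)\<close>, so \<open>a(r') \<le> 2\<^sup>n b(r)\<close> and one more
  covering gives \<open>a(r) \<le> 4\<^sup>n b(r)\<close>. The value of the constant is irrelevant, as long as it does not
  depend on \<open>y\<close> and \<open>r\<close>.\<close>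

lemma mass_ratio_finite: "mass y r \<le> 4 ^ n * mass zero r"
proof -
  define r' where "r' j = r j / sqrt 2" for j
  have r: "r = (\<lambda>j. sqrt 2 * r' j)" by (simp add: r'_def)
  define a where "a = (SUP y. mass y r')"
  have bdd: "bdd_above (range (\<lambda>y. mass y r'))"
    by (intro bdd_aboveI[where M = "measure \<nu> (space \<nu>)"]) (use bounded_measure in auto)
  have le: "mass y r' \<le> a" for y
    unfolding a_def using bdd by (intro cSUP_upper) auto
  have a0: "a \<ge> 0" using le[of zero] measure_nonneg order_trans by blast
  have r_le: "mass y r \<le> 2 ^ n * a" for y
    unfolding r by (rule mass_covering[OF le])
  have "mass y r' \<le> sqrt (2 ^ n * a * mass zero r)" for y
  proof -
    have "mass y r' ^ 2 \<le> mass (\<lambda>j. sqrt 2 * y j) r * mass zero r"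
      unfolding r by (rule mass_square_le)
    also have "\<dots> \<le> 2 ^ n * a * mass zero r" by (intro mult_right_mono r_le) auto
    finally show ?thesis by (rule real_le_rsqrt)
  qed
  then have "a \<le> sqrt (2 ^ n * a * mass zero r)"
    unfolding a_def by (intro cSUP_least) auto
  then have "a ^ 2 \<le> 2 ^ n * a * mass zero r"
    using power_mono[OF _ a0, of "sqrt (2 ^ n * a * mass zero r)" 2] a0 by simp
  then have "a \<le> 2 ^ n * mass zero r"
  proof (cases "a = 0")
    case False
    with a0 have "a > 0" by simp
    moreover have "a * a \<le> a * (2 ^ n * mass zero r)"
      using \<open>a ^ 2 \<le> _\<close> by (simp only: power2_eq_square ac_simps)
    ultimately show ?thesis by (rule mult_left_le_imp_le[rotated])
  qed simp
  then have "2 ^ n * a \<le> 2 ^ n * (2 ^ n * mass zero r)" by simp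
  also have "\<dots> = 4 ^ n * mass zero r" by (simp add: power_mult_distrib [symmetric])
  finally show ?thesis using r_le[of y] by linarith
qed

text \<open>Repeated square roots drive the constant \<open>4\<^sup>n\<close> to 1.\<close>

lemma box_mass_le: "mass y r \<le> mass zero r"
proof -
  have "mass y r \<le> root (2 ^ k) (4 ^ n) * mass zero r" for k y r
  proof (induction k arbitrary: y r)
    case 0
    then show ?case using mass_ratio_finite by simp
  next
    case (Suc k)
    then have "mass y r \<le> sqrt (root (2 ^ k) (4 ^ n)) * mass zero r"
      by (intro mass_sqrt_ratio) auto
    then show ?case by (simp add: sqrt_def real_root_mult_exp mult.commute)
  qed
  moreover have "(\<lambda>k. root (2 ^ k) (4 ^ n) * mass zero r) \<longlonglongrightarrow> 1 * mass zero r"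
  proof (intro tendsto_intros)
    have "strict_mono (\<lambda>k. (2::nat) ^ k)" by (simp add: strict_monoI)
    from LIMSEQ_subseq_LIMSEQ[OF LIMSEQ_root_const[of "4 ^ n"] this]
    show "(\<lambda>k. root (2 ^ k) (4 ^ n)) \<longlonglongrightarrow> (1::real)" by (simp add: o_def)
  qed
  ultimately show ?thesis by (intro LIMSEQ_le_const) auto
qed

end

text \<open>With a norming sequence, a closed ball is the decreasing intersection of boxes with constant radii
  given by finitely many of its functionals.\<close>

lemma closed_ball_mass_le: "measure \<nu> (cball a r) \<le> measure \<nu> (cball 0 r)"
proof -
  obtain F :: "nat \<Rightarrow> 'a \<Rightarrow> real" where F: "\<And>n. bounded_linear (F n)" "\<And>n x. \<bar>F n x\<bar> \<le> norm x"
    "\<And>x r. (\<And>n. \<bar>F n x\<bar> \<le> r) \<Longrightarrow> norm x \<le> r"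
    by (rule norming_sequence) blast
  have cball: "cball c r = (\<Inter>n. cylinder_box F n (\<lambda>j. F j c) (\<lambda>_. r))" for c
  proof (intro set_eqI iffI)
    fix x assume "x \<in> cball c r"
    then have "\<bar>F j x - F j c\<bar> \<le> r" for j
      using F(2)[of j "x - c"] by (simp add: linear_diff[OF bounded_linear.linear[OF F(1)]] dist_norm norm_minus_commute)
    then show "x \<in> (\<Inter>n. cylinder_box F n (\<lambda>j. F j c) (\<lambda>_. r))" by (simp add: cylinder_box_def)
  next
    fix x assume x: "x \<in> (\<Inter>n. cylinder_box F n (\<lambda>j. F j c) (\<lambda>_. r))"
    have "\<bar>F j (x - c)\<bar> \<le> r" for j
    proof -
      have "x \<in> cylinder_box F (Suc j) (\<lambda>j. F j c) (\<lambda>_. r)" using x by blast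
      then show ?thesis
        by (simp add: cylinder_box_def linear_diff[OF bounded_linear.linear[OF F(1)]])
    qed
    then have "norm (x - c) \<le> r" by (rule F(3))
    then show "x \<in> cball c r" by (simp add: dist_norm norm_minus_commute)
  qed
  have lim: "(\<lambda>n. measure \<nu> (cylinder_box F n (\<lambda>j. F j c) (\<lambda>_. r))) \<longlonglongrightarrow> measure \<nu> (cball c r)" for c
    unfolding cball
  proof (rule finite_Lim_measure_decseq)
    show "range (\<lambda>n. cylinder_box F n (\<lambda>j. F j c) (\<lambda>_. r)) \<subseteq> sets \<nu>"
      using cylinder_box_sets[where f = F, OF F(1)] by (simp add: image_subset_iff)
    show "decseq (\<lambda>n. cylinder_box F n (\<lambda>j. F j c) (\<lambda>_. r))"
      unfolding decseq_def cylinder_box_def by fastforce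
  qed
  have le: "measure \<nu> (cylinder_box F n (\<lambda>j. F j a) (\<lambda>_. r)) \<le> measure \<nu> (cylinder_box F n (\<lambda>j. F j 0) (\<lambda>_. r))" for n
    using box_mass_le[where f = F and n = n and y = "\<lambda>j. F j a" and r = "\<lambda>_. r", OF F(1)]
    by (simp add: linear_0[OF bounded_linear.linear[OF F(1)]])
  show ?thesis by (rule LIMSEQ_le[OF lim lim]) (use le in blast)
qed

text \<open>An open ball is the increasing union of the concentric closed balls of smaller radius.\<close>

lemma ball_mass_le: "measure \<nu> (ball a r) \<le> measure \<nu> (ball 0 r)"
proof -
  have ball: "ball c r = (\<Union>k. cball c (r - 1 / Suc k))" for c :: 'a
  proof (intro set_eqI iffI)
    fix x assume "x \<in> ball c r"
    then obtain k where "1 / Suc k < r - dist c x"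
      using nat_approx_posE[of "r - dist c x"] by auto
    then show "x \<in> (\<Union>k. cball c (r - 1 / Suc k))" by (intro UN_I[of k]) auto
  next
    fix x assume "x \<in> (\<Union>k. cball c (r - 1 / Suc k))"
    then obtain k where "dist c x \<le> r - 1 / Suc k" by auto
    moreover have "1 / Suc k > (0::real)" by simp
    ultimately show "x \<in> ball c r" unfolding mem_ball by linarith
  qed
  have lim: "(\<lambda>k. measure \<nu> (cball c (r - 1 / Suc k))) \<longlonglongrightarrow> measure \<nu> (ball c r)" for c
    unfolding ball
  proof (rule finite_Lim_measure_incseq)
    show "incseq (\<lambda>k. cball c (r - 1 / Suc k))"
    proof (intro incseq_SucI subset_cball)
      show "r - 1 / real (Suc k) \<le> r - 1 / real (Suc (Suc k))" for k
        by (simp add: frac_le)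
    qed
  qed auto
  show ?thesis by (rule LIMSEQ_le[OF lim lim]) (use closed_ball_mass_le in blast)
qed

end

section \<open>Normal distributions on the line\<close>

lemma centered_normal_distribution:
  assumes "\<sigma> \<ge> 0"
  shows "integrable (normal_distribution 0 \<sigma>) (\<lambda>x. x\<^sup>2)"
    and "(\<integral>x. x\<^sup>2 \<partial>normal_distribution 0 \<sigma>) = \<sigma>\<^sup>2"
    and "(CLINT x|normal_distribution 0 \<sigma>. iexp x) = exp (- \<sigma>\<^sup>2 / 2)"
    and "\<exists>\<theta>>0. integrable (normal_distribution 0 \<sigma>) (\<lambda>x. exp (\<theta> * x\<^sup>2))"
proof -
  consider "\<sigma> = 0" | "\<sigma> > 0" using assms by linarith
  then have "integrable (normal_distribution 0 \<sigma>) (\<lambda>x. x\<^sup>2) \<and>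
    (\<integral>x. x\<^sup>2 \<partial>normal_distribution 0 \<sigma>) = \<sigma>\<^sup>2 \<and>
    (CLINT x|normal_distribution 0 \<sigma>. iexp x) = exp (- \<sigma>\<^sup>2 / 2) \<and>
    (\<exists>\<theta>>0. integrable (normal_distribution 0 \<sigma>) (\<lambda>x. exp (\<theta> * x\<^sup>2)))"
  proof cases
    case 1
    have int: "integrable (return borel (0::real)) f" if "f \<in> borel_measurable borel" for f :: "real \<Rightarrow> real"
      using that by (simp add: integrable_iff_bounded nn_integral_return)
    show ?thesis using 1
      by (simp add: normal_distribution_def integral_return int) (intro exI[of _ 1]; simp)
  next
    case 2
    have dens: "normal_distribution 0 \<sigma> = density lborel (normal_density 0 \<sigma>)"
      using 2 by (simp add: normal_distribution_def)
    have "integrable lborel (\<lambda>x. normal_density 0 \<sigma> x * x ^ 2)"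
      using integrable_normal_moment[OF 2, of 0 2] by simp
    then have i: "integrable (normal_distribution 0 \<sigma>) (\<lambda>x. x\<^sup>2)"
      unfolding dens by (subst integrable_density) auto
    have "(\<integral>x. x\<^sup>2 \<partial>normal_distribution 0 \<sigma>) = (\<integral>x. normal_density 0 \<sigma> x * x ^ 2 \<partial>lborel)"
      unfolding dens by (subst integral_density) auto
    also have "\<dots> = \<sigma>\<^sup>2"
      using integral_normal_moment_even[OF 2, of 0 1] by (simp add: fact_2)
    finally have ii: "(\<integral>x. x\<^sup>2 \<partial>normal_distribution 0 \<sigma>) = \<sigma>\<^sup>2" .
    have "(CLINT x|normal_distribution 0 \<sigma>. iexp x) = (CLINT x|lborel. normal_density 0 \<sigma> x *\<^sub>R iexp x)"
      unfolding dens by (subst integral_density) auto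
    also have "\<dots> = \<sigma> *\<^sub>R (CLINT x|lborel. normal_density 0 \<sigma> (0 + \<sigma> * x) *\<^sub>R iexp (0 + \<sigma> * x))"
      using 2 lborel_integral_real_affine[of \<sigma> "\<lambda>x. normal_density 0 \<sigma> x *\<^sub>R iexp x" 0] by simp
    also have "\<dots> = (CLINT x|lborel. \<sigma> *\<^sub>R (normal_density 0 \<sigma> (0 + \<sigma> * x) *\<^sub>R iexp (0 + \<sigma> * x)))"
      by (rule integral_scaleR_right [symmetric])
    also have "\<dots> = (CLINT x|lborel. std_normal_density x *\<^sub>R iexp (\<sigma> * x))"
    proof (intro Bochner_Integration.integral_cong refl)
      fix x :: real
      have "\<sigma> * normal_density 0 \<sigma> (0 + \<sigma> * x) = std_normal_density x"
        using 2 by (simp add: normal_density_def real_sqrt_mult power_mult_distrib)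
      then show "\<sigma> *\<^sub>R (normal_density 0 \<sigma> (0 + \<sigma> * x) *\<^sub>R iexp (0 + \<sigma> * x))
          = std_normal_density x *\<^sub>R iexp (\<sigma> * x)"
        by (metis add_0 scaleR_scaleR)
    qed
    also have "\<dots> = char std_normal_distribution \<sigma>"
      unfolding char_def by (subst integral_density) auto
    also have "\<dots> = exp (- \<sigma>\<^sup>2 / 2)" by (simp add: char_std_normal_distribution)
    finally have iii: "(CLINT x|normal_distribution 0 \<sigma>. iexp x) = exp (- \<sigma>\<^sup>2 / 2)" .
    \<comment> \<open>Chosen such that the tilted density is a multiple of the normal density with doubled
      standard deviation.\<close>
    define \<theta> where "\<theta> = 3 / (8 * \<sigma>\<^sup>2)"
    have "normal_density 0 \<sigma> x * exp (\<theta> * x\<^sup>2) = 2 * normal_density 0 (2 * \<sigma>) x" for x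
    proof -
      have "- x\<^sup>2 / (2 * \<sigma>\<^sup>2) + \<theta> * x\<^sup>2 = - x\<^sup>2 / (2 * (2 * \<sigma>)\<^sup>2)"
        using 2 by (simp add: \<theta>_def field_simps)
      then have "exp (- x\<^sup>2 / (2 * \<sigma>\<^sup>2)) * exp (\<theta> * x\<^sup>2) = exp (- x\<^sup>2 / (2 * (2 * \<sigma>)\<^sup>2))"
        by (metis exp_add)
      moreover have "sqrt (2 * pi * (2 * \<sigma>)\<^sup>2) = 2 * sqrt (2 * pi * \<sigma>\<^sup>2)"
      proof -
        have "2 * pi * (2 * \<sigma>)\<^sup>2 = 2\<^sup>2 * (2 * pi * \<sigma>\<^sup>2)" by (simp add: power_mult_distrib)
        then show ?thesis by (simp only: real_sqrt_mult[of "2\<^sup>2"]) simp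
      qed
      ultimately show ?thesis unfolding normal_density_def by simp
    qed
    then have "integrable lborel (\<lambda>x. normal_density 0 \<sigma> x * exp (\<theta> * x\<^sup>2))"
      using integrable_normal_density[of "2 * \<sigma>" 0] 2 by simp
    then have "integrable (normal_distribution 0 \<sigma>) (\<lambda>x. exp (\<theta> * x\<^sup>2))"
      unfolding dens by (subst integrable_density) auto
    moreover have "\<theta> > 0" using 2 by (simp add: \<theta>_def)
    ultimately show ?thesis using i ii iii by blast
  qed
  then show "integrable (normal_distribution 0 \<sigma>) (\<lambda>x. x\<^sup>2)"
    "(\<integral>x. x\<^sup>2 \<partial>normal_distribution 0 \<sigma>) = \<sigma>\<^sup>2"
    "(CLINT x|normal_distribution 0 \<sigma>. iexp x) = exp (- \<sigma>\<^sup>2 / 2)"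
    "\<exists>\<theta>>0. integrable (normal_distribution 0 \<sigma>) (\<lambda>x. exp (\<theta> * x\<^sup>2))"
    by blast+
qed

lemma mean_normal_distribution:
  assumes "\<sigma> \<ge> 0"
  shows "(\<integral>x. x \<partial>normal_distribution m \<sigma>) = m"
proof (cases "\<sigma> = 0")
  case True
  then show ?thesis by (simp add: normal_distribution_def integral_return)
next
  case False
  with assms have "\<sigma> > 0" by simp
  from has_bochner_integral_integral_eq[OF normal_moment_nz_1[OF this]] False show ?thesis
    by (simp add: normal_distribution_def integral_density)
qed

section \<open>Rotation invariance of centred Gaussian measures\<close>

locale centered_gaussian =
  fixes \<mu> :: "'a::{real_normed_vector, second_countable_topology} measure"
  assumes centered_gaussian: "centered_gaussian_measure \<mu>"
begin

sublocale prob_space \<mu>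
  using centered_gaussian by (simp add: centered_gaussian_measure_def gaussian_measure_def)

lemma sets_gaussian [measurable_cong, simp]: "sets \<mu> = sets borel"
  using centered_gaussian by (simp add: centered_gaussian_measure_def gaussian_measure_def)

lemma space_gaussian [simp]: "space \<mu> = UNIV"
  using sets_eq_imp_space_eq[OF sets_gaussian] by simp

lemma functional_distribution:
  assumes f: "bounded_linear f"
  obtains \<sigma> where "\<sigma> \<ge> 0" "distr \<mu> borel f = normal_distribution 0 \<sigma>"
proof -
  have [measurable]: "f \<in> borel_measurable borel" using f by (rule borel_measurable_bounded_linear)
  obtain m \<sigma> where d: "\<sigma> \<ge> 0" "distr \<mu> borel f = normal_distribution m \<sigma>"
    using f centered_gaussian unfolding centered_gaussian_measure_def gaussian_measure_def by blast
  have "m = (\<integral>x. x \<partial>distr \<mu> borel f)" using d mean_normal_distribution by simp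
  also have "\<dots> = (\<integral>x. f x \<partial>\<mu>)" by (simp add: integral_distr)
  also have "\<dots> = 0" using f centered_gaussian unfolding centered_gaussian_measure_def by blast
  finally show ?thesis using that d by simp
qed

lemma functional_moments:
  assumes f: "bounded_linear f"
  shows "integrable \<mu> (\<lambda>x. (f x)\<^sup>2)"
    and "(CLINT x|\<mu>. iexp (f x)) = exp (- (\<integral>x. (f x)\<^sup>2 \<partial>\<mu>) / 2)"
    and "\<exists>\<theta>>0. integrable \<mu> (\<lambda>x. exp (\<theta> * (f x)\<^sup>2))"
proof -
  have [measurable]: "f \<in> borel_measurable borel" using f by (rule borel_measurable_bounded_linear)
  obtain \<sigma> where d: "\<sigma> \<ge> 0" "distr \<mu> borel f = normal_distribution 0 \<sigma>"
    using functional_distribution[OF f] .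
  note n = centered_normal_distribution[OF d(1), folded d(2)]
  show "integrable \<mu> (\<lambda>x. (f x)\<^sup>2)" using n(1) by (simp add: integrable_distr_eq)
  show "(CLINT x|\<mu>. iexp (f x)) = exp (- (\<integral>x. (f x)\<^sup>2 \<partial>\<mu>) / 2)"
    using n(2,3) by (simp add: integral_distr)
  show "\<exists>\<theta>>0. integrable \<mu> (\<lambda>x. exp (\<theta> * (f x)\<^sup>2))"
    using n(4) by (simp add: integrable_distr_eq)
qed

lemma sets_pair: "sets (\<mu> \<Otimes>\<^sub>M \<mu>) = sets borel"
  by (simp add: borel_prod [symmetric] cong: sets_pair_measure_cong)

text \<open>Every functional on the product space is a sum \<open>g(x) + h(y)\<close>, so this is the characteristic
  functional of the product measure. It depends on \<open>g\<close> and \<open>h\<close> only through \<open>g\<^sup>2 + h\<^sup>2\<close>.\<close>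

lemma pair_characteristic_functional:
  assumes g: "bounded_linear g" and h: "bounded_linear h"
  shows "(CLINT z|\<mu> \<Otimes>\<^sub>M \<mu>. iexp (g (fst z) + h (snd z)))
    = exp (- (\<integral>x. (g x)\<^sup>2 + (h x)\<^sup>2 \<partial>\<mu>) / 2)"
proof -
  interpret P: pair_prob_space \<mu> \<mu> ..
  have [measurable]: "g \<in> borel_measurable borel" "h \<in> borel_measurable borel"
    using g h by (auto intro: borel_measurable_bounded_linear)
  have "integrable (\<mu> \<Otimes>\<^sub>M \<mu>) (\<lambda>z. iexp (g (fst z) + h (snd z)))"
    by (rule P.integrable_const_bound[where B = 1]) auto
  from P.integral_fst'[OF this]
  have "(CLINT z|\<mu> \<Otimes>\<^sub>M \<mu>. iexp (g (fst z) + h (snd z))) = (CLINT x|\<mu>. CLINT y|\<mu>. iexp (g x + h y))"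
    by simp
  also have "\<dots> = (CLINT x|\<mu>. CLINT y|\<mu>. iexp (g x) * iexp (h y))"
    by (simp add: exp_add [symmetric] algebra_simps)
  also have "\<dots> = (CLINT x|\<mu>. iexp (g x)) * (CLINT y|\<mu>. iexp (h y))" by simp
  also have "\<dots> = exp (- (\<integral>x. (g x)\<^sup>2 \<partial>\<mu>) / 2 + - (\<integral>x. (h x)\<^sup>2 \<partial>\<mu>) / 2)"
    unfolding functional_moments(2)[OF g] functional_moments(2)[OF h]
    by (simp only: exp_add of_real_mult)
  also have "- (\<integral>x. (g x)\<^sup>2 \<partial>\<mu>) / 2 + - (\<integral>x. (h x)\<^sup>2 \<partial>\<mu>) / 2 = - (\<integral>x. (g x)\<^sup>2 + (h x)\<^sup>2 \<partial>\<mu>) / 2"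
    using functional_moments(1)[OF g] functional_moments(1)[OF h] by simp
  finally show ?thesis .
qed

lemma rotation_measurable_pair [measurable]: "rotation \<in> measurable (\<mu> \<Otimes>\<^sub>M \<mu>) (\<mu> \<Otimes>\<^sub>M \<mu>)"
  using rotation_measurable by (simp cong: measurable_cong_sets sets_pair_measure_cong)

text \<open>Composing \<open>g(x) + h(y)\<close> with the rotation replaces \<open>(g, h)\<close> by \<open>((g + h)/\<surd>2, (g - h)/\<surd>2)\<close>, a
  pair with the same sum of squares.\<close>

lemma pair_rotation_invariant: "distr (\<mu> \<Otimes>\<^sub>M \<mu>) (\<mu> \<Otimes>\<^sub>M \<mu>) rotation = \<mu> \<Otimes>\<^sub>M \<mu>"
proof (rule measure_eqI_characteristic_functional)
  interpret P: pair_prob_space \<mu> \<mu> ..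
  show "finite_measure (\<mu> \<Otimes>\<^sub>M \<mu>)" by (rule P.finite_measure_axioms)
  show "finite_measure (distr (\<mu> \<Otimes>\<^sub>M \<mu>) (\<mu> \<Otimes>\<^sub>M \<mu>) rotation)"
    by (intro P.finite_measure_distr rotation_measurable_pair)
  show "sets (\<mu> \<Otimes>\<^sub>M \<mu>) = sets borel" "sets (distr (\<mu> \<Otimes>\<^sub>M \<mu>) (\<mu> \<Otimes>\<^sub>M \<mu>) rotation) = sets borel"
    by (simp_all only: sets_distr sets_pair)
  fix k :: "'a \<times> 'a \<Rightarrow> real" assume k: "bounded_linear k"
  define g h where "g x = k (x, 0)" and "h x = k (0, x)" for x
  have g: "bounded_linear g" and h: "bounded_linear h"
    unfolding g_def h_def
    by (rule bounded_linear_compose[OF k bounded_linear_Pair], auto intro: bounded_linear_ident bounded_linear_zero)+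
  have kgh: "k z = g (fst z) + h (snd z)" for z
    unfolding g_def h_def using linear_add[OF bounded_linear.linear[OF k], of "(fst z, 0)" "(0, snd z)"] by simp
  define g' h' where "g' x = (g x + h x) / sqrt 2" and "h' x = (g x - h x) / sqrt 2" for x
  have g': "bounded_linear g'" and h': "bounded_linear h'"
    unfolding g'_def h'_def
    by (intro bounded_linear_divide[THEN bounded_linear_compose] bounded_linear_add bounded_linear_sub g h)+
  have rot: "k (rotation z) = g' (fst z) + h' (snd z)" for z
    using bounded_linear.linear[OF g] bounded_linear.linear[OF h]
    by (simp add: kgh rotation_def g'_def h'_def linear_add linear_diff linear_scale field_simps)
  have sq: "(g' x)\<^sup>2 + (h' x)\<^sup>2 = (g x)\<^sup>2 + (h x)\<^sup>2" for x
    by (simp add: g'_def h'_def power_divide power2_eq_square field_simps)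
  have km: "k \<in> borel_measurable (borel \<Otimes>\<^sub>M borel)"
    using borel_measurable_bounded_linear[OF k] by (simp add: borel_prod)
  have "(CLINT z|distr (\<mu> \<Otimes>\<^sub>M \<mu>) (\<mu> \<Otimes>\<^sub>M \<mu>) rotation. iexp (k z)) = (CLINT z|\<mu> \<Otimes>\<^sub>M \<mu>. iexp (k (rotation z)))"
    using km by (intro integral_distr rotation_measurable_pair) measurable
  also have "\<dots> = (CLINT z|\<mu> \<Otimes>\<^sub>M \<mu>. iexp (g' (fst z) + h' (snd z)))" by (simp only: rot)
  also have "\<dots> = (CLINT z|\<mu> \<Otimes>\<^sub>M \<mu>. iexp (g (fst z) + h (snd z)))"
    unfolding pair_characteristic_functional[OF g' h'] pair_characteristic_functional[OF g h] sq ..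
  finally show "(CLINT z|distr (\<mu> \<Otimes>\<^sub>M \<mu>) (\<mu> \<Otimes>\<^sub>M \<mu>) rotation. iexp (k z)) = (CLINT z|\<mu> \<Otimes>\<^sub>M \<mu>. iexp (k z))"
    by (simp only: kgh)
qed

text \<open>The density of the tilted product is \<open>exp(\<theta> (f(x)\<^sup>2 + f(y)\<^sup>2))\<close>, a function of a rotation invariant
  quantity.\<close>

lemma tilted_rotation_invariant:
  assumes f: "bounded_linear f" and int: "integrable \<mu> (\<lambda>x. exp (\<theta> * (f x)\<^sup>2))"
  shows "rotation_invariant_measure (density \<mu> (\<lambda>x. exp (\<theta> * (f x)\<^sup>2)))"
proof -
  let ?w = "\<lambda>x. ennreal (exp (\<theta> * (f x)\<^sup>2))" let ?\<nu> = "density \<mu> ?w"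
  let ?W = "\<lambda>z. ?w (fst z) * ?w (snd z)"
  have [measurable]: "f \<in> borel_measurable borel" using f by (rule borel_measurable_bounded_linear)
  have "(\<integral>\<^sup>+x. ?w x \<partial>\<mu>) = ennreal (\<integral>x. exp (\<theta> * (f x)\<^sup>2) \<partial>\<mu>)"
    using int by (intro nn_integral_eq_integral) auto
  moreover have "emeasure ?\<nu> UNIV = (\<integral>\<^sup>+x. ?w x * indicator UNIV x \<partial>\<mu>)"
    by (rule emeasure_density) auto
  ultimately have "emeasure ?\<nu> (space ?\<nu>) \<noteq> \<infinity>" by simp
  then have fin: "finite_measure ?\<nu>" by (rule finite_measureI)
  then interpret F: finite_measure ?\<nu> .
  have "?\<nu> \<Otimes>\<^sub>M ?\<nu> = density (\<mu> \<Otimes>\<^sub>M \<mu>) (\<lambda>(x, y). ?w x * ?w y)"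
    by (intro pair_measure_density sigma_finite_measure_axioms F.sigma_finite_measure_axioms) auto
  also have "(\<lambda>(x, y). ?w x * ?w y) = ?W" by auto
  finally have pair: "?\<nu> \<Otimes>\<^sub>M ?\<nu> = density (\<mu> \<Otimes>\<^sub>M \<mu>) ?W" .
  have W: "?W (rotation z) = ?W z" for z
  proof -
    have "(f (fst (rotation z)))\<^sup>2 + (f (snd (rotation z)))\<^sup>2 = (f (fst z))\<^sup>2 + (f (snd z))\<^sup>2"
      using bounded_linear.linear[OF f]
      by (simp add: rotation_def linear_add linear_diff linear_scale power_divide power2_eq_square field_simps)
    then show ?thesis
      by (simp add: ennreal_mult [symmetric] exp_add [symmetric] distrib_left [symmetric])
  qed
  have "distr (?\<nu> \<Otimes>\<^sub>M ?\<nu>) (?\<nu> \<Otimes>\<^sub>M ?\<nu>) rotation = distr (density (\<mu> \<Otimes>\<^sub>M \<mu>) (\<lambda>z. ?W (rotation z))) (\<mu> \<Otimes>\<^sub>M \<mu>) rotation"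
    unfolding pair W by (rule distr_cong) auto
  also have "\<dots> = density (distr (\<mu> \<Otimes>\<^sub>M \<mu>) (\<mu> \<Otimes>\<^sub>M \<mu>) rotation) ?W"
    by (intro density_distr [symmetric] rotation_measurable_pair) measurable
  also have "\<dots> = ?\<nu> \<Otimes>\<^sub>M ?\<nu>" unfolding pair_rotation_invariant pair ..
  finally show ?thesis by unfold_locales auto
qed

section \<open>Ball masses and modes\<close>

sublocale rotation_invariant_measure \<mu>
  by unfold_locales (auto simp: pair_rotation_invariant)

text \<open>Otherwise all balls of radius \<open>\<delta>\<close> would be null sets, and countably many of them cover the space.\<close>

lemma ball_mass_pos:
  assumes "\<delta> > 0"
  shows "measure \<mu> (ball 0 \<delta>) > 0"
proof (rule ccontr)
  assume "\<not> ?thesis"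
  then have "measure \<mu> (ball x \<delta>) = 0" for x
    using ball_mass_le[of x \<delta>] measure_nonneg[of \<mu> "ball x \<delta>"] by linarith
  then have null: "emeasure \<mu> (ball x \<delta>) = 0" for x by (simp add: emeasure_eq_measure)
  obtain D :: "'a set" where D: "countable D" "\<And>X. open X \<Longrightarrow> X \<noteq> {} \<Longrightarrow> \<exists>d\<in>D. d \<in> X"
    by (rule countable_dense_setE) blast
  have "x \<in> (\<Union>d\<in>D. ball d \<delta>)" for x
    using D(2)[of "ball x \<delta>"] assms by (auto simp: dist_commute)
  then have "space \<mu> = (\<Union>d\<in>D. ball d \<delta>)" by auto
  moreover have "(\<Union>d\<in>D. ball d \<delta>) \<in> null_sets \<mu>"
    using D(1) null by (intro null_sets_UN') auto
  ultimately show False using emeasure_space_1 by auto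
qed

lemma max_ball_mass_eq: "max_ball_mass \<mu> \<delta> = measure \<mu> (ball 0 \<delta>)"
  unfolding max_ball_mass_def using ball_mass_le
  by (intro antisym cSUP_least cSUP_upper bdd_aboveI2) auto

text \<open>Put \<open>R = \<parallel>x\<parallel> / 4\<close> and tilt by \<open>exp(\<theta> f\<^sup>2)\<close> with \<open>f\<close> norming \<open>x\<close>. On the ball around \<open>w\<close> the
  values of \<open>f\<close> are at least \<open>4 R - 2 R\<close>, on the ball around 0 they are at most \<open>R\<close> in modulus.
  Anderson's inequality for the tilted measure yields \<open>q = exp(\<theta> R\<^sup>2 - 4 \<theta> R\<^sup>2)\<close>.\<close>

lemma off_centre_ratio:
  assumes "x \<noteq> 0"
  obtains q where "q < 1"
    "\<And>w \<delta>. dist w x < norm x / 4 \<Longrightarrow> 0 < \<delta> \<Longrightarrow> \<delta> \<le> norm x / 4 \<Longrightarrow>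
      measure \<mu> (ball w \<delta>) / max_ball_mass \<mu> \<delta> \<le> q"
proof -
  obtain f where f: "bounded_linear f" "\<And>y. \<bar>f y\<bar> \<le> norm y" "f x = norm x"
    by (rule norming_functional[of x]) blast
  have [measurable]: "f \<in> borel_measurable borel" using f(1) by (rule borel_measurable_bounded_linear)
  obtain \<theta> where \<theta>: "\<theta> > 0" "integrable \<mu> (\<lambda>y. exp (\<theta> * (f y)\<^sup>2))"
    using functional_moments(3)[OF f(1)] by blast
  let ?\<nu> = "density \<mu> (\<lambda>y. exp (\<theta> * (f y)\<^sup>2))"
  interpret T: rotation_invariant_measure ?\<nu>
    by (rule tilted_rotation_invariant[OF f(1) \<theta>(2)])
  have tilt: "emeasure ?\<nu> B = (\<integral>\<^sup>+y. ennreal (exp (\<theta> * (f y)\<^sup>2)) * indicator B y \<partial>\<mu>)"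
    if "B \<in> sets borel" for B using that by (intro emeasure_density) auto
  have low: "a * measure \<mu> B \<le> measure ?\<nu> B"
    if B: "B \<in> sets borel" and a: "a \<ge> 0" "\<And>y. y \<in> B \<Longrightarrow> a \<le> exp (\<theta> * (f y)\<^sup>2)" for a B
  proof -
    have "ennreal a * emeasure \<mu> B = (\<integral>\<^sup>+y. ennreal a * indicator B y \<partial>\<mu>)"
      using B by (simp add: nn_integral_cmult_indicator)
    also have "\<dots> \<le> emeasure ?\<nu> B"
      unfolding tilt[OF B] using a by (intro nn_integral_mono) (auto simp: indicator_def ennreal_leI)
    finally show ?thesis
      using a(1) by (simp add: T.emeasure_eq_measure emeasure_eq_measure ennreal_mult [symmetric])
  qed
  have up: "measure ?\<nu> B \<le> a * measure \<mu> B"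
    if B: "B \<in> sets borel" and a: "a \<ge> 0" "\<And>y. y \<in> B \<Longrightarrow> exp (\<theta> * (f y)\<^sup>2) \<le> a" for a B
  proof -
    have "emeasure ?\<nu> B \<le> (\<integral>\<^sup>+y. ennreal a * indicator B y \<partial>\<mu>)"
      unfolding tilt[OF B] using a by (intro nn_integral_mono) (auto simp: indicator_def ennreal_leI)
    also have "\<dots> = ennreal a * emeasure \<mu> B"
      using B by (simp add: nn_integral_cmult_indicator)
    finally show ?thesis
      using a(1) by (simp add: T.emeasure_eq_measure emeasure_eq_measure ennreal_mult [symmetric])
  qed
  define R where "R = norm x / 4"
  have R: "R > 0" using assms by (simp add: R_def)
  define q where "q = exp (\<theta> * R\<^sup>2) / exp (\<theta> * (2 * R)\<^sup>2)"
  show ?thesis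
  proof
    have "\<theta> * R\<^sup>2 < \<theta> * (2 * R)\<^sup>2" using \<theta>(1) R by simp
    then show "q < 1" by (simp add: q_def)
    fix w :: 'a and \<delta> :: real
    assume "dist w x < norm x / 4" and \<delta>: "0 < \<delta>" and "\<delta> \<le> norm x / 4"
    then have w: "dist w x < R" "\<delta> \<le> R" by (auto simp: R_def)
    have "exp (\<theta> * (2 * R)\<^sup>2) * measure \<mu> (ball w \<delta>) \<le> measure ?\<nu> (ball w \<delta>)"
    proof (rule low)
      fix y assume "y \<in> ball w \<delta>"
      then have "norm (x - y) \<le> 2 * R"
        using w dist_triangle[of x y w] by (simp add: dist_norm dist_commute norm_minus_commute)
      moreover have "f x - f y \<le> norm (x - y)"
        using f(2)[of "x - y"] by (simp add: linear_diff[OF bounded_linear.linear[OF f(1)]])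
      ultimately have "2 * R \<le> f y" using f(3) by (simp add: R_def)
      then have "(2 * R)\<^sup>2 \<le> (f y)\<^sup>2" using R by (intro power_mono) auto
      then show "exp (\<theta> * (2 * R)\<^sup>2) \<le> exp (\<theta> * (f y)\<^sup>2)" using \<theta>(1) by simp
    qed auto
    also have "\<dots> \<le> measure ?\<nu> (ball 0 \<delta>)" by (rule T.ball_mass_le)
    also have "\<dots> \<le> exp (\<theta> * R\<^sup>2) * measure \<mu> (ball 0 \<delta>)"
    proof (rule up)
      fix y :: 'a assume "y \<in> ball 0 \<delta>"
      then have "\<bar>f y\<bar> \<le> \<bar>R\<bar>" using f(2)[of y] w(2) R by simp
      then have "(f y)\<^sup>2 \<le> R\<^sup>2" by (simp only: abs_le_square_iff)
      then show "exp (\<theta> * (f y)\<^sup>2) \<le> exp (\<theta> * R\<^sup>2)" using \<theta>(1) by simp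
    qed auto
    finally show "measure \<mu> (ball w \<delta>) / max_ball_mass \<mu> \<delta> \<le> q"
      using ball_mass_pos[OF \<delta>] by (simp add: max_ball_mass_eq q_def field_simps)
  qed
qed

end

lemma strong_mode_imp_generalized_mode:
  assumes "strong_mode \<mu> x"
  shows "generalized_mode \<mu> x"
  unfolding generalized_mode_def
proof (intro allI impI)
  fix \<delta> :: "nat \<Rightarrow> real" assume "\<forall>n. \<delta> n > 0" "\<delta> \<longlonglongrightarrow> 0"
  then have "filterlim \<delta> (at_right 0) sequentially"
    by (auto simp: filterlim_at intro!: always_eventually) (metis less_irrefl)
  then have "(\<lambda>n. measure \<mu> (ball x (\<delta> n)) / max_ball_mass \<mu> (\<delta> n)) \<longlonglongrightarrow> 1"
    using assms unfolding strong_mode_def by (rule filterlim_compose[rotated])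
  then show "\<exists>w. w \<longlonglongrightarrow> x \<and> (\<lambda>n. measure \<mu> (ball (w n) (\<delta> n)) / max_ball_mass \<mu> (\<delta> n)) \<longlonglongrightarrow> 1"
    by (intro exI[of _ "\<lambda>_. x"]) simp
qed

theorem theorem2p7:
  fixes \<mu> :: "'a::{banach, second_countable_topology} measure"
  assumes "centered_gaussian_measure \<mu>"
  shows "strong_mode \<mu> 0 \<and> generalized_mode \<mu> 0 \<and>
         (\<forall>x. x \<noteq> 0 \<longrightarrow> \<not> strong_mode \<mu> x \<and> \<not> generalized_mode \<mu> x)"
proof -
  interpret centered_gaussian \<mu> by unfold_locales fact
  have "eventually (\<lambda>\<delta>. measure \<mu> (ball 0 \<delta>) / max_ball_mass \<mu> \<delta> = 1) (at_right 0)"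
    using eventually_at_right_less[of 0]
  proof eventually_elim
    case (elim \<delta>)
    then show ?case using ball_mass_pos[OF elim] by (simp add: max_ball_mass_eq)
  qed
  then have strong: "strong_mode \<mu> 0"
    unfolding strong_mode_def by (rule tendsto_eventually)
  have not_generalized: "\<not> generalized_mode \<mu> x" if x0: "x \<noteq> 0" for x
  proof
    assume gen: "generalized_mode \<mu> x"
    obtain q where q: "q < 1"
      "\<And>w \<delta>. dist w x < norm x / 4 \<Longrightarrow> 0 < \<delta> \<Longrightarrow> \<delta> \<le> norm x / 4 \<Longrightarrow>
        measure \<mu> (ball w \<delta>) / max_ball_mass \<mu> \<delta> \<le> q"
      using off_centre_ratio[OF x0] by blast
    define \<delta> where "\<delta> n = norm x / 4 / real (Suc n)" for n
    have \<delta>: "0 < \<delta> n" "\<delta> n \<le> norm x / 4" for n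
      using x0 by (auto simp: \<delta>_def divide_simps)
    have "\<delta> \<longlonglongrightarrow> 0" unfolding \<delta>_def by real_asymp
    then obtain w where w: "w \<longlonglongrightarrow> x"
      "(\<lambda>n. measure \<mu> (ball (w n) (\<delta> n)) / max_ball_mass \<mu> (\<delta> n)) \<longlonglongrightarrow> 1"
      using gen \<delta>(1) unfolding generalized_mode_def by blast
    have "eventually (\<lambda>n. dist (w n) x < norm x / 4) sequentially"
      using w(1) x0 by (intro tendstoD) auto
    then have "eventually (\<lambda>n. measure \<mu> (ball (w n) (\<delta> n)) / max_ball_mass \<mu> (\<delta> n) \<le> q) sequentially"
      by eventually_elim (use q(2) \<delta> in blast)
    from tendsto_upperbound[OF w(2) this] q(1) show False by simp
  qed
  show ?thesis
    using strong not_generalized strong_mode_imp_generalized_mode by blast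
qed

end
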